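(* Let $\mathcal X,\mathcal Y$ be separable real Hilbert spaces with $\mathcal Y\ne\{0\}$, and let $C\in L(\mathcal X)$ be compact and self-adjoint with spectral decomposition $C=\sum_{\lambda\in\sigma_{\rm p}(C)}\lambda P_{\operatorname{eig}_\lambda(C)}$. Let $g\colon\mathbb R\to\mathbb R$ be extended to act on self-adjoint Hilbert space operators with a discrete spectrum in terms of their spectral decompositions via $g(C):=\sum_{\lambda\in\sigma_{\rm p}(C)}g(\lambda)P_{\operatorname{eig}_\lambda(C)}$. Then the operator $A_C\colon S_2(\mathcal X,\mathcal Y)\to S_2(\mathcal X,\mathcal Y)$, $A_C[\theta]=\theta C$, satisfies $$A_{g(C)}=g(A_C),$$ with each of the series defining $g(C)$ and $g(A_C)$ converging in operator norm if and only if the other does.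
   Context: $S_2(\mathcal X,\mathcal Y)$ is the Hilbert space of Hilbert--Schmidt operators $\mathcal X\to\mathcal Y$ with inner product $\operatorname{tr}(A^*B)$. $\sigma_{\rm p}(T)$ is the set of eigenvalues of $T$, $\operatorname{eig}_\lambda(T)=\ker(T-\lambda\operatorname{Id})$, and $P_E$ denotes the orthogonal projection onto a closed subspace $E$. For $B\in L(\mathcal X)$, $A_B[\theta]=\theta B$. The operator $g(A_C)$ is defined by the same recipe, $g(A_C)=\sum_{\lambda\in\sigma_{\rm p}(A_C)}g(\lambda)P_{\operatorname{eig}_\lambda(A_C)}$, where the projections are orthogonal projections on $S_2(\mathcal X,\mathcal Y)$; here $\sigma_{\rm p}(A_C)=\sigma_{\rm p}(C)$ and $\operatorname{eig}_\lambda(A_C)=\mathcal Y\otimes\operatorname{eig}_\lambda(C)$ (the closed linear span in $S_2(\mathcal X,\mathcal Y)$ of the rank-one operators $w\mapsto\langle v,w\rangle_{\mathcal X}y$ with $y\in\mathcal Y$, $v\in\operatorname{eig}_\lambda(C)$). *)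

theory Defs
  imports "HOL-Analysis.Analysis"
begin

section \<open>Hilbert spaces and orthonormal bases\<close>

class hilbert_space = real_inner + banach

definition orthonormal :: "'a::real_inner set \<Rightarrow> bool" where
  "orthonormal B \<longleftrightarrow> (\<forall>e\<in>B. norm e = 1) \<and> pairwise orthogonal B"

definition orthonormal_basis :: "'a::real_inner set \<Rightarrow> bool" where
  "orthonormal_basis B \<longleftrightarrow> orthonormal B \<and> closure (span B) = UNIV"

lemma orthonormal_subset: "orthonormal B \<Longrightarrow> C \<subseteq> B \<Longrightarrow> orthonormal C"
  unfolding orthonormal_def by (auto intro: pairwise_subset)

lemma orthonormal_inner:
  "orthonormal B \<Longrightarrow> e \<in> B \<Longrightarrow> f \<in> B \<Longrightarrow> inner e f = (if e = f then 1 else 0)"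
  unfolding orthonormal_def pairwise_def orthogonal_def
  by (auto simp: norm_eq_1)

lemma orthonormal_norm_sum:
  assumes "orthonormal B" "finite F" "F \<subseteq> B"
  shows "(norm (\<Sum>e\<in>F. c e *\<^sub>R e))\<^sup>2 = (\<Sum>e\<in>F. (c e)\<^sup>2)"
proof -
  have "pairwise (\<lambda>i j. orthogonal (c i *\<^sub>R i) (c j *\<^sub>R j)) F"
    using assms unfolding orthonormal_def pairwise_def orthogonal_def by auto
  from norm_sum_Pythagorean[OF assms(2) this]
  have "(norm (\<Sum>e\<in>F. c e *\<^sub>R e))\<^sup>2 = (\<Sum>e\<in>F. (norm (c e *\<^sub>R e))\<^sup>2)" .
  also have "\<dots> = (\<Sum>e\<in>F. (c e)\<^sup>2)"
    by (rule sum.cong) (use assms in \<open>auto simp: orthonormal_def\<close>)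
  finally show ?thesis .
qed

lemma real_sq_bound:
  fixes s b :: real
  assumes "s \<le> b * sqrt s" "0 \<le> s" "0 \<le> b"
  shows "s \<le> b\<^sup>2"
proof (cases "s = 0")
  case False
  then have "sqrt s > 0" using assms by auto
  moreover have "sqrt s * sqrt s \<le> b * sqrt s" using assms by simp
  ultimately have "sqrt s \<le> b" by (rule mult_right_le_imp_le[rotated])
  then show ?thesis using assms by (metis real_sqrt_le_iff real_sqrt_pow2 power_mono real_sqrt_ge_zero)
qed auto

lemma orthonormal_sum_sq_le:
  fixes T :: "'a::real_inner \<Rightarrow>\<^sub>L 'b::real_inner"
  assumes "orthonormal F" "finite F"
  shows "(\<Sum>e\<in>F. (inner (T e) y)\<^sup>2) \<le> (norm T * norm y)\<^sup>2"
proof (rule real_sq_bound)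
  let ?s = "\<Sum>e\<in>F. (inner (T e) y)\<^sup>2"
  let ?v = "\<Sum>e\<in>F. inner (T e) y *\<^sub>R e"
  have "?s = inner (T ?v) y"
    by (simp add: blinfun.sum_right blinfun.scaleR_right inner_sum_left power2_eq_square)
  also have "\<dots> \<le> norm (T ?v) * norm y" by (rule norm_cauchy_schwarz)
  also have "\<dots> \<le> (norm T * norm ?v) * norm y"
    by (intro mult_right_mono norm_blinfun) auto
  also have "norm ?v = sqrt ?s"
    by (rule real_sqrt_unique[symmetric, OF orthonormal_norm_sum[OF assms(1,2) order_refl] norm_ge_zero])
  finally show "?s \<le> norm T * norm y * sqrt ?s" by (simp only: mult_ac)
qed (auto intro: sum_nonneg)

lemma bessel:
  assumes "orthonormal F" "finite F"
  shows "(\<Sum>e\<in>F. (inner x e)\<^sup>2) \<le> (norm x)\<^sup>2"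
proof -
  have "(\<Sum>e\<in>F. (inner x e)\<^sup>2) \<le> (norm (id_blinfun :: 'a \<Rightarrow>\<^sub>L 'a) * norm x)\<^sup>2"
    using orthonormal_sum_sq_le[OF assms, of id_blinfun x] by (simp add: inner_commute)
  also have "\<dots> \<le> (1 * norm x)\<^sup>2"
    by (intro power_mono mult_right_mono norm_blinfun_bound) auto
  finally show ?thesis by simp
qed

lemma summable_on_bounded_sums:
  fixes f :: "'i \<Rightarrow> real"
  assumes "\<And>i. i \<in> A \<Longrightarrow> 0 \<le> f i" "\<And>F. finite F \<Longrightarrow> F \<subseteq> A \<Longrightarrow> sum f F \<le> b"
  shows "f summable_on A" "infsum f A \<le> b"
proof -
  show s: "f summable_on A"
    by (rule nonneg_bdd_above_summable_on) (use assms in \<open>auto intro!: bdd_aboveI[of _ b]\<close>)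
  show "infsum f A \<le> b"
    by (rule infsum_le_finite_sums[OF s]) (use assms in auto)
qed

lemma summable_on_CauchyI:
  fixes f :: "'i \<Rightarrow> 'b::banach"
  assumes "\<And>d. d > 0 \<Longrightarrow> \<exists>F. finite F \<and> F \<subseteq> A \<and>
             (\<forall>G. finite G \<and> G \<subseteq> A \<and> G \<inter> F = {} \<longrightarrow> norm (sum f G) < d)"
  shows "f summable_on A"
proof -
  have "\<exists>P. eventually P (finite_subsets_at_top A) \<and>
          (\<forall>F F'. P F \<and> P F' \<longrightarrow> dist (sum f F) (sum f F') < d)" if d: "d > 0" for d
  proof -
    obtain F0 where F0: "finite F0" "F0 \<subseteq> A"
      "\<And>G. finite G \<and> G \<subseteq> A \<and> G \<inter> F0 = {} \<Longrightarrow> norm (sum f G) < d/2"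
      using assms[OF half_gt_zero[OF d]] by (elim exE conjE) simp
    define P where "P F \<longleftrightarrow> finite F \<and> F0 \<subseteq> F \<and> F \<subseteq> A" for F
    have "eventually P (finite_subsets_at_top A)"
      unfolding eventually_finite_subsets_at_top P_def using F0(1,2) by (intro exI[of _ F0]) simp
    moreover have "dist (sum f F) (sum f F') < d" if "P F" "P F'" for F F'
    proof -
      have *: "norm (sum f G - sum f F0) < d/2" if "P G" for G
      proof -
        have "sum f G - sum f F0 = sum f (G - F0)"
          using that unfolding P_def by (simp add: sum_diff)
        also have "norm \<dots> < d/2"
          by (rule F0(3)) (use that in \<open>auto simp: P_def\<close>)
        finally show ?thesis .
      qed
      have "dist (sum f F) (sum f F') \<le> dist (sum f F) (sum f F0) + dist (sum f F') (sum f F0)"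
        by (rule dist_triangle2)
      also have "\<dots> < d"
        using *[OF that(1)] *[OF that(2)] unfolding dist_norm by linarith
      finally show ?thesis .
    qed
    ultimately show ?thesis by (intro exI[of _ P]) simp
  qed
  then have "cauchy_filter (filtermap (sum f) (finite_subsets_at_top A))"
    by (simp add: cauchy_filter_metric_filtermap)
  moreover have "complete (UNIV::'b set)"
    by (meson Cauchy_convergent UNIV_I complete_def convergent_def)
  ultimately obtain L' where "(sum f \<longlongrightarrow> L') (finite_subsets_at_top A)"
    using complete_uniform[where S=UNIV] by (force simp add: filterlim_def)
  then show ?thesis
    using summable_on_def has_sum_def by blast
qed

lemma orthonormal_summable_on:
  fixes B :: "'a::hilbert_space set"
  assumes B: "orthonormal B" and c: "(\<lambda>e. (c e)\<^sup>2) summable_on B"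
  shows "(\<lambda>e. c e *\<^sub>R e) summable_on B"
proof (rule summable_on_CauchyI)
  fix d :: real assume d: "d > 0"
  let ?q = "\<lambda>e. (c e)\<^sup>2"
  obtain F where F: "finite F" "F \<subseteq> B" "dist (sum ?q F) (infsum ?q B) \<le> d\<^sup>2/2"
    using infsum_finite_approximation[OF c, of "d\<^sup>2/2"] d by auto
  have "norm (\<Sum>e\<in>G. c e *\<^sub>R e) < d" if G: "finite G" "G \<subseteq> B" "G \<inter> F = {}" for G
  proof -
    have "sum ?q F + sum ?q G = sum ?q (F \<union> G)"
      using F G by (subst sum.union_disjoint) auto
    also have "\<dots> \<le> infsum ?q B"
      by (rule finite_sum_le_infsum[OF c]) (use F G in auto)
    finally have "sum ?q G \<le> d\<^sup>2/2" using F(3) unfolding dist_real_def by linarith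
    also have "\<dots> < d\<^sup>2" using d by simp
    finally have "(norm (\<Sum>e\<in>G. c e *\<^sub>R e))\<^sup>2 < d\<^sup>2"
      using orthonormal_norm_sum[OF B G(1,2), of c] by simp
    then show ?thesis using d by (meson less_eq_real_def power2_less_imp_less)
  qed
  then show "\<exists>F. finite F \<and> F \<subseteq> B \<and>
      (\<forall>G. finite G \<and> G \<subseteq> B \<and> G \<inter> F = {} \<longrightarrow> norm (\<Sum>e\<in>G. c e *\<^sub>R e) < d)"
    using F by blast
qed

lemma orthonormal_summable_coeffs:
  fixes B :: "'a::hilbert_space set"
  assumes "orthonormal B"
  shows "(\<lambda>e. (inner x e)\<^sup>2) summable_on B" "(\<lambda>e. inner x e *\<^sub>R e) summable_on B"
proof -
  show "(\<lambda>e. (inner x e)\<^sup>2) summable_on B"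
    by (rule summable_on_bounded_sums(1)[where b = "(norm x)\<^sup>2"])
       (use orthonormal_subset[OF assms] in \<open>auto intro!: bessel\<close>)
  then show "(\<lambda>e. inner x e *\<^sub>R e) summable_on B"
    by (rule orthonormal_summable_on[OF assms])
qed

lemma orthonormal_has_sum_inner:
  fixes B :: "'a::hilbert_space set"
  assumes B: "orthonormal B" and s: "((\<lambda>e. c e *\<^sub>R e) has_sum s) B" and f: "f \<in> B"
  shows "inner s f = c f"
proof -
  have "((\<lambda>e. inner (c e *\<^sub>R e) f) has_sum inner s f) B"
    by (rule has_sum_bounded_linear[OF bounded_linear_inner_left s])
  moreover have "((\<lambda>e. inner (c e *\<^sub>R e) f) has_sum c f) B"
    by (rule has_sum_finite_neutralI[of "{f}"])
       (use B f in \<open>auto simp: orthonormal_inner\<close>)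
  ultimately show ?thesis by (rule has_sum_unique)
qed

lemma has_sum_finite_sum:
  fixes f :: "'j \<Rightarrow> 'i \<Rightarrow> 'b::topological_comm_monoid_add"
  assumes "\<And>j. (f j has_sum s j) A"
  shows "((\<lambda>i. \<Sum>j\<in>J. f j i) has_sum (\<Sum>j\<in>J. s j)) A"
  by (induction J rule: infinite_finite_induct) (auto intro: has_sum_add assms)

lemma has_sum_in_closed_subspace:
  assumes "closed E" "subspace E" "(f has_sum s) A" "\<And>i. i \<in> A \<Longrightarrow> f i \<in> E"
  shows "s \<in> E"
proof (rule Lim_in_closed_set)
  show "(sum f \<longlongrightarrow> s) (finite_subsets_at_top A)" using assms(3) by (simp add: has_sum_def)
  show "\<forall>\<^sub>F F in finite_subsets_at_top A. sum f F \<in> E"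
    by (rule eventually_finite_subsets_at_top_weakI) (use assms in \<open>auto intro!: subspace_sum\<close>)
qed (use assms in auto)

lemma closed_subspace_basis:
  fixes E :: "'a::hilbert_space set"
  assumes E: "closed E" "subspace E"
  obtains B where "orthonormal B" "B \<subseteq> E" "\<And>x. x \<in> E \<Longrightarrow> ((\<lambda>e. inner x e *\<^sub>R e) has_sum x) B"
proof -
  have "\<exists>M\<in>{B. orthonormal B \<and> B \<subseteq> E}. \<forall>X\<in>{B. orthonormal B \<and> B \<subseteq> E}. M \<subseteq> X \<longrightarrow> X = M"
  proof (rule subset_Zorn_nonempty)
    show "{B. orthonormal B \<and> B \<subseteq> E} \<noteq> {}" by (auto intro!: exI[of _ "{}"] simp: orthonormal_def)
    fix \<C> assume C: "\<C> \<noteq> {}" "subset.chain {B. orthonormal B \<and> B \<subseteq> E} \<C>"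
    have "orthonormal (\<Union>\<C>)"
      unfolding orthonormal_def
    proof
      show "\<forall>e\<in>\<Union>\<C>. norm e = 1" using C unfolding subset.chain_def orthonormal_def by blast
      show "pairwise orthogonal (\<Union>\<C>)"
        unfolding pairwise_def
      proof (intro ballI impI)
        fix x y assume "x \<in> \<Union>\<C>" "y \<in> \<Union>\<C>" "x \<noteq> y"
        then obtain X Y where XY: "X \<in> \<C>" "Y \<in> \<C>" "x \<in> X" "y \<in> Y" by blast
        then have "X \<subseteq> Y \<or> Y \<subseteq> X" using C unfolding subset_chain_def by blast
        then obtain Z where "Z \<in> \<C>" "x \<in> Z" "y \<in> Z" using XY by blast
        moreover have "orthonormal Z" using C \<open>Z \<in> \<C>\<close> unfolding subset_chain_def by blast
        ultimately show "orthogonal x y" using \<open>x \<noteq> y\<close> unfolding orthonormal_def pairwise_def by blast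
      qed
    qed
    moreover have "\<Union>\<C> \<subseteq> E" using C unfolding subset_chain_def by blast
    ultimately show "\<Union>\<C> \<in> {B. orthonormal B \<and> B \<subseteq> E}" by simp
  qed
  then obtain B where B: "orthonormal B" "B \<subseteq> E"
    and max: "\<And>X. orthonormal X \<Longrightarrow> X \<subseteq> E \<Longrightarrow> B \<subseteq> X \<Longrightarrow> X = B" by auto
  have "((\<lambda>e. inner x e *\<^sub>R e) has_sum x) B" if x: "x \<in> E" for x
  proof -
    obtain s where s: "((\<lambda>e. inner x e *\<^sub>R e) has_sum s) B"
      using orthonormal_summable_coeffs(2)[OF B(1), of x] by (auto simp: summable_on_def)
    have sE: "s \<in> E"
      by (rule has_sum_in_closed_subspace[OF E s]) (use B E in \<open>auto intro: subspace_scale\<close>)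
    have perp: "inner (x - s) e = 0" if "e \<in> B" for e
      using orthonormal_has_sum_inner[OF B(1) s that] by (simp add: inner_diff_left)
    have "x = s"
    proof (rule ccontr)
      assume ne: "x \<noteq> s"
      define u where "u = (x - s) /\<^sub>R norm (x - s)"
      have nu: "norm u = 1" using ne by (simp add: u_def)
      have pu: "inner u e = 0" if "e \<in> B" for e using perp[OF that] by (simp add: u_def)
      have "orthonormal (insert u B)"
        using B(1) nu pu unfolding orthonormal_def
        by (auto simp: pairwise_insert orthogonal_def inner_commute)
      moreover have "u \<in> E" unfolding u_def using x sE E by (intro subspace_scale subspace_diff)
      ultimately have "insert u B = B" using max B(2) by auto
      then have "u \<in> B" by auto
      then have "inner u u = 0" using pu by blast
      then show False using nu by simp
    qed
    then show ?thesis using s by simp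
  qed
  then show thesis using that B by blast
qed

lemma ex_orthonormal_basis: "\<exists>B :: 'a::hilbert_space set. orthonormal_basis B"
proof -
  obtain B :: "'a set" where B: "orthonormal B" "\<And>x. ((\<lambda>e. inner x e *\<^sub>R e) has_sum x) B"
    by (rule closed_subspace_basis[of UNIV]) auto
  have "x \<in> closure (span B)" for x
  proof (rule Lim_in_closed_set)
    show "(sum (\<lambda>e. inner x e *\<^sub>R e) \<longlongrightarrow> x) (finite_subsets_at_top B)"
      using B(2) by (simp add: has_sum_def)
    show "\<forall>\<^sub>F F in finite_subsets_at_top B. (\<Sum>e\<in>F. inner x e *\<^sub>R e) \<in> closure (span B)"
      by (intro eventually_finite_subsets_at_top_weakI closure_subset[THEN subsetD] span_sum span_scale)
         (auto intro: span_base)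
  qed auto
  then show ?thesis using B(1) unfolding orthonormal_basis_def by auto
qed

lemma orthonormal_basis_expansion:
  fixes B :: "'a::hilbert_space set"
  assumes "orthonormal_basis B"
  shows "((\<lambda>e. inner x e *\<^sub>R e) has_sum x) B"
proof -
  have B: "orthonormal B" "closure (span B) = UNIV" using assms by (auto simp: orthonormal_basis_def)
  obtain s where s: "((\<lambda>e. inner x e *\<^sub>R e) has_sum s) B"
    using orthonormal_summable_coeffs(2)[OF B(1), of x] by (auto simp: summable_on_def)
  let ?N = "{y. inner (x - s) y = 0}"
  have "B \<subseteq> ?N"
    using orthonormal_has_sum_inner[OF B(1) s] by (auto simp: inner_diff_left)
  then have "span B \<subseteq> ?N"
    by (rule span_minimal) (simp add: subspace_hyperplane)
  then have "closure (span B) \<subseteq> ?N"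
    by (rule closure_minimal) (simp add: closed_hyperplane)
  then have "inner (x - s) (x - s) = 0" using B(2) by blast
  then show ?thesis using s by simp
qed

lemma parseval:
  fixes B :: "'a::hilbert_space set"
  assumes "orthonormal_basis B"
  shows "((\<lambda>e. inner x e * inner y e) has_sum inner x y) B"
  using has_sum_bounded_linear[OF bounded_linear_inner_left[of y] orthonormal_basis_expansion[OF assms, of x]]
  by (simp add: inner_commute)

lemma parseval_norm:
  fixes B :: "'a::hilbert_space set"
  assumes "orthonormal_basis B"
  shows "((\<lambda>e. (inner x e)\<^sup>2) has_sum (norm x)\<^sup>2) B"
  using parseval[OF assms, of x x] by (simp add: power2_eq_square dot_square_norm)

lemma adjoint_blinfun_works:
  fixes T :: "'a::hilbert_space \<Rightarrow>\<^sub>L 'b::real_inner"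
  shows "inner x (adjoint (blinfun_apply T) y) = inner (T x) y"
proof -
  have "\<exists>z. \<forall>x. inner (T x) y = inner x z" for y
  proof -
    obtain B :: "'a set" where B: "orthonormal_basis B" using ex_orthonormal_basis by blast
    then have B': "orthonormal B" by (simp add: orthonormal_basis_def)
    have "(\<lambda>e. (inner (T e) y)\<^sup>2) summable_on B"
      by (rule summable_on_bounded_sums(1)[where b = "(norm T * norm y)\<^sup>2"])
         (use orthonormal_subset[OF B'] in \<open>auto intro!: orthonormal_sum_sq_le\<close>)
    from orthonormal_summable_on[OF B' this]
    obtain z where z: "((\<lambda>e. inner (T e) y *\<^sub>R e) has_sum z) B" by (auto simp: summable_on_def)
    have "inner (T x) y = inner x z" for x
    proof -
      have "((\<lambda>e. T (inner x e *\<^sub>R e)) has_sum T x) B"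
        by (rule has_sum_bounded_linear[OF blinfun.bounded_linear_right orthonormal_basis_expansion[OF B]])
      then have "((\<lambda>e. inner (T (inner x e *\<^sub>R e)) y) has_sum inner (T x) y) B"
        by (rule has_sum_bounded_linear[OF bounded_linear_inner_left])
      moreover have "((\<lambda>e. inner x (inner (T e) y *\<^sub>R e)) has_sum inner x z) B"
        by (rule has_sum_bounded_linear[OF bounded_linear_inner_right z])
      moreover have "(\<lambda>e. inner x (inner (T e) y *\<^sub>R e)) = (\<lambda>e. inner (T (inner x e *\<^sub>R e)) y)"
        by (rule ext) (simp add: blinfun.scaleR_right)
      ultimately show ?thesis using has_sum_unique by metis
    qed
    then show ?thesis by blast
  qed
  then obtain f where f: "\<And>x y. inner (T x) y = inner x (f y)" by metis
  have "\<forall>x y. inner (T x) y = inner x (adjoint (blinfun_apply T) y)"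
    unfolding adjoint_def by (rule someI[where x = f]) (simp add: f)
  then show ?thesis by simp
qed


section \<open>Hilbert--Schmidt operators\<close>

definition some_onb :: "'a::hilbert_space set" where
  "some_onb = (SOME B. orthonormal_basis B)"

lemma orthonormal_basis_some_onb: "orthonormal_basis some_onb"
  unfolding some_onb_def using ex_orthonormal_basis by (rule someI_ex)

definition op_trace :: "('a::hilbert_space \<Rightarrow> 'a) \<Rightarrow> real" where
  "op_trace T = (\<Sum>\<^sub>\<infinity>e\<in>some_onb. inner e (T e))"

definition hilbert_schmidt :: "('a::hilbert_space \<Rightarrow>\<^sub>L 'b::hilbert_space) \<Rightarrow> bool" where
  "hilbert_schmidt T \<longleftrightarrow> (\<lambda>e. (norm (T e))\<^sup>2) summable_on some_onb"

text \<open>Neither \<^const>\<open>hilbert_schmidt\<close> nor the value of the series depends on the basis.\<close>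

lemma sum_norm_adjoint_le:
  fixes T :: "'a::hilbert_space \<Rightarrow>\<^sub>L 'b::hilbert_space"
  assumes B: "orthonormal_basis B" and s: "((\<lambda>e. (norm (T e))\<^sup>2) has_sum s) B"
    and H: "orthonormal H" "finite H"
  shows "(\<Sum>y\<in>H. (norm (adjoint (blinfun_apply T) y))\<^sup>2) \<le> s"
proof -
  have "((\<lambda>e. (inner (adjoint (blinfun_apply T) y) e)\<^sup>2) has_sum (norm (adjoint (blinfun_apply T) y))\<^sup>2) B" for y
    by (rule parseval_norm[OF B])
  then have "((\<lambda>e. (inner (T e) y)\<^sup>2) has_sum (norm (adjoint (blinfun_apply T) y))\<^sup>2) B" for y
    by (simp add: inner_commute[of "adjoint _ _"] adjoint_blinfun_works)
  then have "((\<lambda>e. \<Sum>y\<in>H. (inner (T e) y)\<^sup>2) has_sum (\<Sum>y\<in>H. (norm (adjoint (blinfun_apply T) y))\<^sup>2)) B"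
    by (rule has_sum_finite_sum)
  then show ?thesis
    by (rule has_sum_mono[OF _ s]) (use H in \<open>auto intro: bessel\<close>)
qed

lemma sum_norm_comp_le:
  fixes T :: "'a::hilbert_space \<Rightarrow>\<^sub>L 'b::hilbert_space" and C :: "'c::hilbert_space \<Rightarrow>\<^sub>L 'a"
  assumes B: "orthonormal_basis B" and s: "((\<lambda>e. (norm (T e))\<^sup>2) has_sum s) B"
    and F: "orthonormal F" "finite F"
  shows "(\<Sum>e\<in>F. (norm (T (C e)))\<^sup>2) \<le> (norm C)\<^sup>2 * s"
proof -
  obtain Y :: "'b set" where Y: "orthonormal_basis Y" using ex_orthonormal_basis by blast
  have "((\<lambda>y. \<Sum>e\<in>F. (inner (T (C e)) y)\<^sup>2) has_sum (\<Sum>e\<in>F. (norm (T (C e)))\<^sup>2)) Y"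
    by (intro has_sum_finite_sum parseval_norm[OF Y])
  then show ?thesis
  proof (rule has_sum_le_finite_sums)
    fix H assume H: "finite H" "H \<subseteq> Y"
    then have oH: "orthonormal H" using Y orthonormal_subset[of Y H] by (simp add: orthonormal_basis_def)
    have "(\<Sum>y\<in>H. \<Sum>e\<in>F. (inner (T (C e)) y)\<^sup>2) \<le> (\<Sum>y\<in>H. (norm C)\<^sup>2 * (norm (adjoint (blinfun_apply T) y))\<^sup>2)"
    proof (rule sum_mono)
      fix y
      have "(\<Sum>e\<in>F. (inner (T (C e)) y)\<^sup>2) = (\<Sum>e\<in>F. (inner (C e) (adjoint (blinfun_apply T) y))\<^sup>2)"
        by (simp add: adjoint_blinfun_works)
      also have "\<dots> \<le> (norm C * norm (adjoint (blinfun_apply T) y))\<^sup>2"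
        by (rule orthonormal_sum_sq_le[OF F])
      finally show "(\<Sum>e\<in>F. (inner (T (C e)) y)\<^sup>2) \<le> (norm C)\<^sup>2 * (norm (adjoint (blinfun_apply T) y))\<^sup>2"
        by (simp add: power_mult_distrib)
    qed
    also have "\<dots> = (norm C)\<^sup>2 * (\<Sum>y\<in>H. (norm (adjoint (blinfun_apply T) y))\<^sup>2)"
      by (simp add: sum_distrib_left)
    also have "\<dots> \<le> (norm C)\<^sup>2 * s"
      by (intro mult_left_mono sum_norm_adjoint_le[OF B s oH H(1)]) auto
    finally show "(\<Sum>y\<in>H. \<Sum>e\<in>F. (inner (T (C e)) y)\<^sup>2) \<le> (norm C)\<^sup>2 * s" .
  qed
qed

lemma has_sum_norm_basis_indep:
  fixes T :: "'a::hilbert_space \<Rightarrow>\<^sub>L 'b::hilbert_space"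
  assumes B: "orthonormal_basis B" "orthonormal_basis B'"
    and s: "((\<lambda>e. (norm (T e))\<^sup>2) has_sum s) B"
  shows "((\<lambda>e. (norm (T e))\<^sup>2) has_sum s) B'"
proof -
  have le: "(\<lambda>e. (norm (T e))\<^sup>2) summable_on D' \<and> infsum (\<lambda>e. (norm (T e))\<^sup>2) D' \<le> t"
    if D: "orthonormal_basis D" "orthonormal_basis D'" and t: "((\<lambda>e. (norm (T e))\<^sup>2) has_sum t) D" for D D' t
  proof -
    have "0 \<le> t" using t by (rule has_sum_nonneg) auto
    have "sum (\<lambda>e. (norm (T e))\<^sup>2) F \<le> t" if "finite F" "F \<subseteq> D'" for F
    proof -
      have "orthonormal F" using that D orthonormal_subset[of D' F] by (simp add: orthonormal_basis_def)
      from sum_norm_comp_le[OF D(1) t this that(1), of id_blinfun]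
      have "sum (\<lambda>e. (norm (T e))\<^sup>2) F \<le> (norm (id_blinfun :: 'a \<Rightarrow>\<^sub>L 'a))\<^sup>2 * t" by simp
      also have "\<dots> \<le> 1\<^sup>2 * t"
        by (intro mult_right_mono power_mono norm_blinfun_bound) (use \<open>0 \<le> t\<close> in auto)
      finally show ?thesis by simp
    qed
    then show ?thesis using summable_on_bounded_sums[of D' "\<lambda>e. (norm (T e))\<^sup>2" t] by auto
  qed
  have 1: "(\<lambda>e. (norm (T e))\<^sup>2) summable_on B'" "infsum (\<lambda>e. (norm (T e))\<^sup>2) B' \<le> s"
    using le[OF B s] by auto
  have "s \<le> infsum (\<lambda>e. (norm (T e))\<^sup>2) B'"
    using le[OF B(2,1) has_sum_infsum[OF 1(1)]] s by (simp add: infsumI)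
  then have "s = infsum (\<lambda>e. (norm (T e))\<^sup>2) B'" using 1(2) by (rule order_antisym)
  then show ?thesis using has_sum_infsum[OF 1(1)] by simp
qed

lemma hilbert_schmidt_basis_indep:
  fixes T :: "'a::hilbert_space \<Rightarrow>\<^sub>L 'b::hilbert_space"
  assumes "orthonormal_basis B"
  shows "hilbert_schmidt T \<longleftrightarrow> (\<lambda>e. (norm (T e))\<^sup>2) summable_on B"
  unfolding hilbert_schmidt_def summable_on_def
  using has_sum_norm_basis_indep assms orthonormal_basis_some_onb by blast

lemma hilbert_schmidt_scaleR: "hilbert_schmidt S \<Longrightarrow> hilbert_schmidt (r *\<^sub>R S)"
  unfolding hilbert_schmidt_def
  by (simp add: blinfun.scaleR_left power_mult_distrib summable_on_cmult_right)

lemma hilbert_schmidt_add: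
  assumes "hilbert_schmidt S" "hilbert_schmidt T"
  shows "hilbert_schmidt (S + T)"
proof -
  have "(\<lambda>e. 2 * (norm (S e))\<^sup>2 + 2 * (norm (T e))\<^sup>2) summable_on some_onb"
    using assms unfolding hilbert_schmidt_def by (intro summable_on_add summable_on_cmult_right)
  then show ?thesis
    unfolding hilbert_schmidt_def
  proof (rule summable_on_comparison_test)
    fix e
    have "norm ((S + T) e) \<le> norm (S e) + norm (T e)"
      by (simp add: blinfun.add_left norm_triangle_ineq)
    then have "(norm ((S + T) e))\<^sup>2 \<le> (norm (S e) + norm (T e))\<^sup>2" by (intro power_mono) auto
    also have "\<dots> \<le> 2 * (norm (S e))\<^sup>2 + 2 * (norm (T e))\<^sup>2"
      using sum_squares_bound[of "norm (S e)" "norm (T e)"] by (simp add: power2_sum)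
    finally show "(norm ((S + T) e))\<^sup>2 \<le> 2 * (norm (S e))\<^sup>2 + 2 * (norm (T e))\<^sup>2" .
  qed auto
qed

lemma hilbert_schmidt_diff:
  assumes "hilbert_schmidt S" "hilbert_schmidt T"
  shows "hilbert_schmidt (S - T)"
  using hilbert_schmidt_add[OF assms(1) hilbert_schmidt_scaleR[OF assms(2), of "-1"]] by simp

lemma hilbert_schmidt_inner_summable:
  assumes "hilbert_schmidt S" "hilbert_schmidt T"
  shows "(\<lambda>e. inner (S e) (T e)) summable_on some_onb"
proof -
  have "(\<lambda>e. inner (S e) (T e)) =
    (\<lambda>e. (1/4) * ((norm ((S + T) e))\<^sup>2 + (- 1) * (norm ((S - T) e))\<^sup>2))"
    by (auto simp: fun_eq_iff blinfun.add_left blinfun.diff_left power2_norm_eq_inner algebra_simps inner_commute)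
  moreover have "\<dots> summable_on some_onb"
    using hilbert_schmidt_add[OF assms] hilbert_schmidt_diff[OF assms]
    unfolding hilbert_schmidt_def
    by (intro summable_on_cmult_right summable_on_add)
  ultimately show ?thesis by (simp only:)
qed

typedef (overloaded) ('a, 'b) hs = "{T :: 'a::hilbert_space \<Rightarrow>\<^sub>L 'b::hilbert_space. hilbert_schmidt T}"
  morphisms hs_op Hs
  by (auto intro!: exI[of _ 0] simp: hilbert_schmidt_def)

setup_lifting type_definition_hs

instantiation hs :: (hilbert_space, hilbert_space) real_inner
begin

lift_definition zero_hs :: "('a, 'b) hs" is 0
  by (simp add: hilbert_schmidt_def)

lift_definition plus_hs :: "('a, 'b) hs \<Rightarrow> ('a, 'b) hs \<Rightarrow> ('a, 'b) hs" is "(+)"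
  by (rule hilbert_schmidt_add)

lift_definition minus_hs :: "('a, 'b) hs \<Rightarrow> ('a, 'b) hs \<Rightarrow> ('a, 'b) hs" is "(-)"
  by (rule hilbert_schmidt_diff)

lift_definition uminus_hs :: "('a, 'b) hs \<Rightarrow> ('a, 'b) hs" is uminus
proof -
  fix T :: "'a \<Rightarrow>\<^sub>L 'b" assume "hilbert_schmidt T"
  from hilbert_schmidt_scaleR[OF this, of "-1"] show "hilbert_schmidt (- T)" by simp
qed

lift_definition scaleR_hs :: "real \<Rightarrow> ('a, 'b) hs \<Rightarrow> ('a, 'b) hs" is "(*\<^sub>R)"
  by (rule hilbert_schmidt_scaleR)

definition inner_hs :: "('a, 'b) hs \<Rightarrow> ('a, 'b) hs \<Rightarrow> real" where
  "inner_hs S T = op_trace (adjoint (blinfun_apply (hs_op S)) \<circ> blinfun_apply (hs_op T))"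

definition norm_hs :: "('a, 'b) hs \<Rightarrow> real" where
  "norm_hs S = sqrt (inner S S)"

definition dist_hs :: "('a, 'b) hs \<Rightarrow> ('a, 'b) hs \<Rightarrow> real" where
  "dist_hs S T = norm (S - T)"

definition sgn_hs :: "('a, 'b) hs \<Rightarrow> ('a, 'b) hs" where
  "sgn_hs S = scaleR (inverse (norm S)) S"

definition uniformity_hs :: "(('a, 'b) hs \<times> ('a, 'b) hs) filter" where
  "uniformity_hs = (INF e\<in>{0 <..}. principal {(x, y). dist x y < e})"

definition open_hs :: "('a, 'b) hs set \<Rightarrow> bool" where
  "open_hs S = (\<forall>x\<in>S. \<forall>\<^sub>F (x', y) in uniformity. x' = x \<longrightarrow> y \<in> S)"

lemma inner_hs_has_sum:
  fixes S T :: "('a, 'b) hs"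
  shows "((\<lambda>e. inner (hs_op S e) (hs_op T e)) has_sum inner S T) some_onb"
  unfolding inner_hs_def op_trace_def o_def adjoint_blinfun_works
  using hs_op[of S] hs_op[of T] by (auto intro: has_sum_infsum hilbert_schmidt_inner_summable)

instance
proof
  fix x y z :: "('a, 'b) hs" and a b :: real
  show "x + y + z = x + (y + z)" by transfer simp
  show "x + y = y + x" by transfer simp
  show "0 + x = x" by transfer simp
  show "- x + x = 0" by transfer simp
  show "x - y = x + - y" by transfer simp
  show "a *\<^sub>R (x + y) = a *\<^sub>R x + a *\<^sub>R y" by transfer (simp add: scaleR_add_right)
  show "(a + b) *\<^sub>R x = a *\<^sub>R x + b *\<^sub>R x" by transfer (simp add: scaleR_add_left)
  show "a *\<^sub>R b *\<^sub>R x = (a * b) *\<^sub>R x" by transfer simp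
  show "1 *\<^sub>R x = x" by transfer simp
  have "((\<lambda>e. inner (hs_op x e) (hs_op y e)) has_sum inner y x) some_onb"
    using inner_hs_has_sum[of y x] by (subst inner_commute)
  with inner_hs_has_sum[of x y] show "inner x y = inner y x" by (rule has_sum_unique)
  have "((\<lambda>e. inner (hs_op (x + y) e) (hs_op z e)) has_sum inner x z + inner y z) some_onb"
    using has_sum_add[OF inner_hs_has_sum[of x z] inner_hs_has_sum[of y z]]
    by (simp add: plus_hs.rep_eq blinfun.add_left inner_add_left)
  with inner_hs_has_sum[of "x + y" z] show "inner (x + y) z = inner x z + inner y z"
    by (rule has_sum_unique)
  have "((\<lambda>e. inner (hs_op (a *\<^sub>R x) e) (hs_op y e)) has_sum a * inner x y) some_onb"
    using has_sum_cmult_right[OF inner_hs_has_sum[of x y], of a]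
    by (simp add: scaleR_hs.rep_eq blinfun.scaleR_left)
  with inner_hs_has_sum[of "a *\<^sub>R x" y] show "inner (a *\<^sub>R x) y = a * inner x y"
    by (rule has_sum_unique)
  show "0 \<le> inner x x"
    by (rule has_sum_nonneg[OF inner_hs_has_sum]) auto
  show "inner x x = 0 \<longleftrightarrow> x = 0"
  proof
    assume 0: "inner x x = 0"
    have z: "hs_op x e = 0" if "e \<in> some_onb" for e
      using nonneg_has_sum_le_0D[OF inner_hs_has_sum[of x x] _ _ that] 0 by simp
    have "hs_op x v = 0" for v
    proof -
      have "((\<lambda>e. hs_op x (inner v e *\<^sub>R e)) has_sum hs_op x v) some_onb"
        by (rule has_sum_bounded_linear[OF blinfun.bounded_linear_right
              orthonormal_basis_expansion[OF orthonormal_basis_some_onb]])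
      moreover have "((\<lambda>e. hs_op x (inner v e *\<^sub>R e)) has_sum 0) some_onb"
        by (rule has_sum_0) (simp add: blinfun.scaleR_right z)
      ultimately show ?thesis by (rule has_sum_unique)
    qed
    then show "x = 0" by (auto simp: hs_op_inject[symmetric] zero_hs.rep_eq intro!: blinfun_eqI)
  next
    assume "x = 0"
    then have "((\<lambda>e. inner (hs_op x e) (hs_op x e)) has_sum 0) some_onb"
      by (simp add: zero_hs.rep_eq)
    with inner_hs_has_sum[of x x] show "inner x x = 0" by (rule has_sum_unique)
  qed
qed (rule norm_hs_def dist_hs_def sgn_hs_def uniformity_hs_def open_hs_def)+

end

lemma norm_hs_has_sum: "((\<lambda>e. (norm (hs_op S e))\<^sup>2) has_sum (norm S)\<^sup>2) some_onb"
  using inner_hs_has_sum[of S S] by (simp add: power2_norm_eq_inner)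

lemma norm_hs_has_sum_basis:
  "orthonormal_basis B \<Longrightarrow> ((\<lambda>e. (norm (hs_op S e))\<^sup>2) has_sum (norm S)\<^sup>2) B"
  by (rule has_sum_norm_basis_indep[OF orthonormal_basis_some_onb _ norm_hs_has_sum])

lemma inner_hs_has_sum_basis:
  assumes B: "orthonormal_basis B"
  shows "((\<lambda>e. inner (hs_op S e) (hs_op T e)) has_sum inner S T) B"
proof -
  have "((\<lambda>e. (1/4) * ((norm (hs_op (S + T) e))\<^sup>2 + (- 1) * (norm (hs_op (S - T) e))\<^sup>2))
     has_sum (1/4) * ((norm (S + T))\<^sup>2 + (- 1) * (norm (S - T))\<^sup>2)) B"
    by (intro has_sum_cmult_right has_sum_add norm_hs_has_sum_basis B)
  moreover have "(\<lambda>e. (1/4) * ((norm (hs_op (S + T) e))\<^sup>2 + (- 1) * (norm (hs_op (S - T) e))\<^sup>2))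
     = (\<lambda>e. inner (hs_op S e) (hs_op T e))"
    by (auto simp: fun_eq_iff plus_hs.rep_eq minus_hs.rep_eq blinfun.add_left blinfun.diff_left
        power2_norm_eq_inner algebra_simps inner_commute)
  moreover have "(1/4) * ((norm (S + T))\<^sup>2 + (- 1) * (norm (S - T))\<^sup>2) = inner S T"
    by (simp add: power2_norm_eq_inner algebra_simps inner_commute)
  ultimately show ?thesis by simp
qed

lemma norm_hs_op_le: "norm (hs_op S) \<le> norm S"
proof (rule norm_blinfun_bound)
  fix x
  have x: "((\<lambda>e. hs_op S (inner x e *\<^sub>R e)) has_sum hs_op S x) some_onb"
    by (rule has_sum_bounded_linear[OF blinfun.bounded_linear_right
          orthonormal_basis_expansion[OF orthonormal_basis_some_onb]])
  have oB: "orthonormal (some_onb :: 'a set)"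
    using orthonormal_basis_some_onb orthonormal_basis_def by blast
  have "norm (sum (\<lambda>e. hs_op S (inner x e *\<^sub>R e)) F) \<le> norm S * norm x"
    if F: "finite F" "F \<subseteq> some_onb" for F
  proof -
    have "norm (sum (\<lambda>e. hs_op S (inner x e *\<^sub>R e)) F) \<le> (\<Sum>e\<in>F. \<bar>norm (hs_op S e)\<bar> * \<bar>inner x e\<bar>)"
      by (rule order_trans[OF norm_sum]) (simp add: blinfun.scaleR_right mult.commute)
    also have "\<dots> \<le> L2_set (\<lambda>e. norm (hs_op S e)) F * L2_set (inner x) F"
      by (rule L2_set_mult_ineq)
    also have "\<dots> \<le> norm S * norm x"
    proof (rule mult_mono)
      have "(\<Sum>e\<in>F. (norm (hs_op S e))\<^sup>2) \<le> (norm S)\<^sup>2"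
        by (rule finite_sum_le_has_sum[OF norm_hs_has_sum]) (use F in auto)
      then show "L2_set (\<lambda>e. norm (hs_op S e)) F \<le> norm S"
        unfolding L2_set_def by (rule real_le_lsqrt[OF norm_ge_zero])
      have "(\<Sum>e\<in>F. (inner x e)\<^sup>2) \<le> (norm x)\<^sup>2"
        by (rule bessel) (use F orthonormal_subset[OF oB] in auto)
      then show "L2_set (inner x) F \<le> norm x"
        unfolding L2_set_def by (rule real_le_lsqrt[OF norm_ge_zero])
    qed (auto simp: L2_set_nonneg)
    finally show ?thesis .
  qed
  then have "\<forall>\<^sub>F F in finite_subsets_at_top some_onb.
      norm (sum (\<lambda>e. hs_op S (inner x e *\<^sub>R e)) F) \<le> norm S * norm x"
    by (intro eventually_finite_subsets_at_top_weakI) auto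
  then show "norm (hs_op S x) \<le> norm S * norm x"
    by (rule tendsto_upperbound[OF tendsto_norm[OF x[unfolded has_sum_def]]]) auto
qed auto

instance hs :: (hilbert_space, hilbert_space) hilbert_space
proof
  fix X :: "nat \<Rightarrow> ('a, 'b) hs"
  assume X: "Cauchy X"
  have "Cauchy (\<lambda>n. hs_op (X n))"
  proof (rule metric_CauchyI)
    fix d :: real assume "d > 0"
    then obtain N where N: "\<And>m n. m \<ge> N \<Longrightarrow> n \<ge> N \<Longrightarrow> dist (X m) (X n) < d"
      using metric_CauchyD[OF X] by blast
    have "dist (hs_op (X m)) (hs_op (X n)) \<le> dist (X m) (X n)" for m n
      using norm_hs_op_le[of "X m - X n"] by (simp add: dist_norm minus_hs.rep_eq)
    then show "\<exists>N. \<forall>m\<ge>N. \<forall>n\<ge>N. dist (hs_op (X m)) (hs_op (X n)) < d"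
      using N by (meson le_less_trans)
  qed
  then obtain T where T: "(\<lambda>n. hs_op (X n)) \<longlonglongrightarrow> T" by (auto simp: Cauchy_convergent_iff convergent_def)
  have bound: "\<exists>N. \<forall>n\<ge>N. \<forall>F. finite F \<longrightarrow> F \<subseteq> some_onb \<longrightarrow>
      (\<Sum>e\<in>F. (norm ((T - hs_op (X n)) e))\<^sup>2) \<le> d\<^sup>2" if d: "d > 0" for d
  proof -
    obtain N where N: "\<And>m n. m \<ge> N \<Longrightarrow> n \<ge> N \<Longrightarrow> dist (X m) (X n) < d"
      using metric_CauchyD[OF X d] by blast
    have "(\<Sum>e\<in>F. (norm ((T - hs_op (X n)) e))\<^sup>2) \<le> d\<^sup>2"
      if n: "n \<ge> N" and F: "finite F" "F \<subseteq> some_onb" for n F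
    proof (rule LIMSEQ_le_const2)
      show "(\<lambda>m. \<Sum>e\<in>F. (norm ((hs_op (X m) - hs_op (X n)) e))\<^sup>2)
          \<longlonglongrightarrow> (\<Sum>e\<in>F. (norm ((T - hs_op (X n)) e))\<^sup>2)"
        by (intro tendsto_sum tendsto_power tendsto_norm blinfun.tendsto tendsto_diff T tendsto_const)
      have "(\<Sum>e\<in>F. (norm ((hs_op (X m) - hs_op (X n)) e))\<^sup>2) \<le> d\<^sup>2" if "m \<ge> N" for m
      proof -
        have "(\<Sum>e\<in>F. (norm (hs_op (X m - X n) e))\<^sup>2) \<le> (norm (X m - X n))\<^sup>2"
          by (rule finite_sum_le_has_sum[OF norm_hs_has_sum]) (use F in auto)
        also have "\<dots> \<le> d\<^sup>2"
          using N[OF that n] by (intro power_mono) (auto simp: dist_norm)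
        finally show ?thesis by (simp add: minus_hs.rep_eq)
      qed
      then show "\<exists>N. \<forall>m\<ge>N. (\<Sum>e\<in>F. (norm ((hs_op (X m) - hs_op (X n)) e))\<^sup>2) \<le> d\<^sup>2" by blast
    qed
    then show ?thesis by blast
  qed
  have hs: "hilbert_schmidt T"
  proof -
    obtain N where N: "\<And>F. finite F \<Longrightarrow> F \<subseteq> some_onb \<Longrightarrow>
      (\<Sum>e\<in>F. (norm ((T - hs_op (X N)) e))\<^sup>2) \<le> 1\<^sup>2" using bound[of 1] by auto
    have "hilbert_schmidt (T - hs_op (X N))"
      unfolding hilbert_schmidt_def
      by (rule summable_on_bounded_sums(1)[where b = "1\<^sup>2"]) (use N in auto)
    from hilbert_schmidt_add[OF this, of "hs_op (X N)"] show ?thesis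
      using hs_op[of "X N"] by simp
  qed
  have "X \<longlonglongrightarrow> Hs T"
  proof (rule metric_LIMSEQ_I)
    fix r :: real assume r: "r > 0"
    obtain N where N: "\<And>n F. n \<ge> N \<Longrightarrow> finite F \<Longrightarrow> F \<subseteq> some_onb \<Longrightarrow>
      (\<Sum>e\<in>F. (norm ((T - hs_op (X n)) e))\<^sup>2) \<le> (r/2)\<^sup>2" using bound[of "r/2"] r by auto
    have "dist (X n) (Hs T) < r" if "n \<ge> N" for n
    proof -
      have eq: "hs_op (Hs T - X n) = T - hs_op (X n)"
        using hs by (simp add: minus_hs.rep_eq Hs_inverse)
      have "(norm (Hs T - X n))\<^sup>2 \<le> (r/2)\<^sup>2"
        by (rule has_sum_le_finite_sums[OF norm_hs_has_sum]) (use N[OF that] in \<open>auto simp: eq\<close>)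
      then have "norm (Hs T - X n) \<le> r/2"
        using r by (auto intro: power2_le_imp_le)
      then show ?thesis using r by (simp add: dist_norm norm_minus_commute)
    qed
    then show "\<exists>N. \<forall>n\<ge>N. dist (X n) (Hs T) < r" by blast
  qed
  then show "convergent X" by (auto simp: convergent_def)
qed

lift_definition hs_comp :: "('b::hilbert_space, 'c::hilbert_space) hs \<Rightarrow> ('a::hilbert_space \<Rightarrow>\<^sub>L 'b) \<Rightarrow> ('a, 'c) hs"
  is "\<lambda>T B. T o\<^sub>L B"
proof -
  fix T :: "'b \<Rightarrow>\<^sub>L 'c" and B :: "'a \<Rightarrow>\<^sub>L 'b"
  assume "hilbert_schmidt T"
  then obtain s where s: "((\<lambda>e. (norm (T e))\<^sup>2) has_sum s) some_onb"
    by (auto simp: hilbert_schmidt_def summable_on_def)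
  have oB: "orthonormal (some_onb :: 'a set)"
    using orthonormal_basis_some_onb orthonormal_basis_def by blast
  show "hilbert_schmidt (T o\<^sub>L B)"
    unfolding hilbert_schmidt_def
  proof (rule summable_on_bounded_sums(1)[where b = "(norm B)\<^sup>2 * s"])
    fix F :: "'a set" assume "finite F" "F \<subseteq> some_onb"
    then show "(\<Sum>e\<in>F. (norm ((T o\<^sub>L B) e))\<^sup>2) \<le> (norm B)\<^sup>2 * s"
      using sum_norm_comp_le[OF orthonormal_basis_some_onb s, of F B] orthonormal_subset[OF oB] by simp
  qed auto
qed

lemma norm_hs_comp: "norm (hs_comp S B) \<le> norm S * norm B"
proof -
  have "(norm (hs_comp S B))\<^sup>2 \<le> (norm B)\<^sup>2 * (norm S)\<^sup>2"
  proof (rule has_sum_le_finite_sums[OF norm_hs_has_sum])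
    fix F :: "'a set" assume "finite F" "F \<subseteq> some_onb"
    moreover from this have "orthonormal F"
      using orthonormal_subset[of "some_onb :: 'a set" F] orthonormal_basis_some_onb
      unfolding orthonormal_basis_def by blast
    ultimately show "(\<Sum>e\<in>F. (norm (hs_op (hs_comp S B) e))\<^sup>2) \<le> (norm B)\<^sup>2 * (norm S)\<^sup>2"
      using sum_norm_comp_le[OF orthonormal_basis_some_onb norm_hs_has_sum, of F S B]
      by (simp add: hs_comp.rep_eq)
  qed
  then have "(norm (hs_comp S B))\<^sup>2 \<le> (norm S * norm B)\<^sup>2"
    by (simp add: power_mult_distrib mult.commute)
  then show ?thesis by (rule power2_le_imp_le) simp
qed

section \<open>The operator \<open>\<theta> \<mapsto> \<theta> B\<close>\<close>

lift_definition right_mult ::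
  "('a::hilbert_space \<Rightarrow>\<^sub>L 'a) \<Rightarrow> ('a, 'b::hilbert_space) hs \<Rightarrow>\<^sub>L ('a, 'b) hs"
  is "\<lambda>B \<theta>. hs_comp \<theta> B"
proof (rule bounded_linear_intro)
  fix B :: "'a \<Rightarrow>\<^sub>L 'a" and x y :: "('a, 'b) hs" and r :: real
  show "hs_comp (x + y) B = hs_comp x B + hs_comp y B"
    by transfer (auto intro!: blinfun_eqI simp: blinfun.add_left)
  show "hs_comp (r *\<^sub>R x) B = r *\<^sub>R hs_comp x B"
    by transfer (auto intro!: blinfun_eqI simp: blinfun.scaleR_left)
  show "norm (hs_comp x B) \<le> norm x * norm B"
    by (rule norm_hs_comp)
qed

lemma hs_op_right_mult: "hs_op (right_mult B \<theta>) = hs_op \<theta> o\<^sub>L B"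
  by (simp add: right_mult.rep_eq hs_comp.rep_eq)

section \<open>Compact and self-adjoint operators, functions of operators\<close>

definition compact_operator :: "('a::real_normed_vector \<Rightarrow>\<^sub>L 'b::real_normed_vector) \<Rightarrow> bool" where
  "compact_operator T \<longleftrightarrow> compact (closure (T ` cball 0 1))"

definition selfadjoint :: "('a::real_inner \<Rightarrow>\<^sub>L 'a) \<Rightarrow> bool" where
  "selfadjoint T \<longleftrightarrow> (\<forall>x y. inner (T x) y = inner x (T y))"

definition eigenspace :: "('a::real_normed_vector \<Rightarrow>\<^sub>L 'a) \<Rightarrow> real \<Rightarrow> 'a set" where
  "eigenspace T l = {x. (T - l *\<^sub>R id_blinfun) x = 0}"

definition point_spectrum :: "('a::real_normed_vector \<Rightarrow>\<^sub>L 'a) \<Rightarrow> real set" where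
  "point_spectrum T = {l. \<exists>x. x \<noteq> 0 \<and> T x = l *\<^sub>R x}"

definition orth_proj :: "'a::hilbert_space set \<Rightarrow> 'a \<Rightarrow>\<^sub>L 'a" where
  "orth_proj E = (THE P :: 'a \<Rightarrow>\<^sub>L 'a. \<forall>x. P x \<in> E \<and> (\<forall>y\<in>E. inner (x - P x) y = 0))"

lemma orth_proj_unique:
  fixes P Q :: "'a::hilbert_space \<Rightarrow>\<^sub>L 'a"
  assumes E: "subspace E"
    and P: "\<forall>x. P x \<in> E \<and> (\<forall>y\<in>E. inner (x - P x) y = 0)"
    and Q: "\<forall>x. Q x \<in> E \<and> (\<forall>y\<in>E. inner (x - Q x) y = 0)"
  shows "P = Q"
proof (rule blinfun_eqI)
  fix x
  have d: "P x - Q x \<in> E" using P Q E by (simp add: subspace_diff)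
  have "inner (P x - Q x) (P x - Q x)
      = inner (x - Q x) (P x - Q x) - inner (x - P x) (P x - Q x)"
    by (simp add: inner_diff_left)
  also have "\<dots> = 0" using P Q d by simp
  finally show "P x = Q x" by simp
qed

lemma ex_orth_proj:
  fixes E :: "'a::hilbert_space set"
  assumes E: "closed E" "subspace E"
  shows "\<exists>P :: 'a \<Rightarrow>\<^sub>L 'a. \<forall>x. P x \<in> E \<and> (\<forall>y\<in>E. inner (x - P x) y = 0)"
proof -
  obtain B where B: "orthonormal B" "B \<subseteq> E"
    and ex: "\<And>x. x \<in> E \<Longrightarrow> ((\<lambda>e. inner x e *\<^sub>R e) has_sum x) B"
    by (rule closed_subspace_basis[OF E]) (rule that)
  define p where "p x = (\<Sum>\<^sub>\<infinity>e\<in>B. inner x e *\<^sub>R e)" for x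
  have p: "((\<lambda>e. inner x e *\<^sub>R e) has_sum p x) B" for x
    unfolding p_def by (rule has_sum_infsum[OF orthonormal_summable_coeffs(2)[OF B(1)]])
  have pE: "p x \<in> E" for x
    by (rule has_sum_in_closed_subspace[OF E p]) (use B E in \<open>auto intro: subspace_scale\<close>)
  have perp: "inner (x - p x) y = 0" if y: "y \<in> E" for x y
  proof -
    have "((\<lambda>e. inner (x - p x) (inner y e *\<^sub>R e)) has_sum inner (x - p x) y) B"
      by (rule has_sum_bounded_linear[OF bounded_linear_inner_right ex[OF y]])
    moreover have "((\<lambda>e. inner (x - p x) (inner y e *\<^sub>R e)) has_sum 0) B"
      by (rule has_sum_0) (simp add: inner_diff_left orthonormal_has_sum_inner[OF B(1) p])
    ultimately show ?thesis by (rule has_sum_unique)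
  qed
  have "bounded_linear p"
  proof (rule bounded_linear_intro)
    fix x y :: 'a and r :: real
    show "p (x + y) = p x + p y"
      by (rule has_sum_unique[OF p[of "x + y"]])
         (use has_sum_add[OF p[of x] p[of y]] in \<open>simp add: inner_add_left scaleR_add_left\<close>)
    show "p (r *\<^sub>R x) = r *\<^sub>R p x"
      by (rule has_sum_unique[OF p[of "r *\<^sub>R x"]])
         (use has_sum_bounded_linear[OF bounded_linear_scaleR_right[of r] p[of x]] in simp)
    have "(norm x)\<^sup>2 = (norm (x - p x + p x))\<^sup>2" by simp
    also have "\<dots> = (norm (x - p x))\<^sup>2 + (norm (p x))\<^sup>2"
      by (rule norm_add_Pythagorean) (simp add: orthogonal_def perp pE)
    finally have "(norm (p x))\<^sup>2 \<le> (norm x)\<^sup>2" by simp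
    then have "norm (p x) \<le> norm x" by (rule power2_le_imp_le) simp
    then show "norm (p x) \<le> norm x * 1" by simp
  qed
  then show ?thesis using pE perp by (intro exI[of _ "Blinfun p"]) (simp add: bounded_linear_Blinfun_apply)
qed

lemma orth_proj_works:
  fixes E :: "'a::hilbert_space set"
  assumes E: "closed E" "subspace E"
  shows "orth_proj E x \<in> E" "y \<in> E \<Longrightarrow> inner (x - orth_proj E x) y = 0"
proof -
  have "\<exists>!P :: 'a \<Rightarrow>\<^sub>L 'a. \<forall>x. P x \<in> E \<and> (\<forall>y\<in>E. inner (x - P x) y = 0)"
    using ex_orth_proj[OF E] orth_proj_unique[OF E(2)] by (rule ex_ex1I)
  from theI'[OF this, folded orth_proj_def]
  show "orth_proj E x \<in> E" "y \<in> E \<Longrightarrow> inner (x - orth_proj E x) y = 0" by auto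
qed

lemma closed_subspace_eigenspace: "closed (eigenspace T l)" "subspace (eigenspace T l)"
proof -
  show "closed (eigenspace T l)"
    unfolding eigenspace_def
    by (intro closed_Collect_eq linear_continuous_on blinfun.bounded_linear_right continuous_on_const)
  show "subspace (eigenspace T l)"
    unfolding eigenspace_def by (auto simp: subspace_def blinfun.add_right blinfun.scaleR_right)
qed

text \<open>The series \<open>\<Sum>\<^bsub>l\<^esub> g(l) P\<^bsub>l\<^esub>\<close> over the eigenvalues comes without an order, so its sums are the
  unordered ones. Operator norm convergence is too strong as the definition of \<open>g(T)\<close>: if \<open>g\<close> is
  bounded on an infinite point spectrum but does not vanish at its limit point, the series defines
  a bounded operator without converging in norm (\<open>g = 1\<close> gives the resolution of the identity).
  So \<open>g(T)\<close> is the pointwise sum, which is the norm sum whenever the latter exists, and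
  norm convergence is a separate predicate. \<open>spectral_fun\<close> has the default value 0 when there is
  no bounded operator \<open>g(T)\<close>.\<close>

definition spectral_series :: "(real \<Rightarrow> real) \<Rightarrow> ('a::hilbert_space \<Rightarrow>\<^sub>L 'a) \<Rightarrow> real \<Rightarrow> 'a \<Rightarrow>\<^sub>L 'a" where
  "spectral_series g T l = g l *\<^sub>R orth_proj (eigenspace T l)"

definition norm_convergent_spectral_series :: "(real \<Rightarrow> real) \<Rightarrow> ('a::hilbert_space \<Rightarrow>\<^sub>L 'a) \<Rightarrow> bool" where
  "norm_convergent_spectral_series g T \<longleftrightarrow> spectral_series g T summable_on point_spectrum T"

definition has_spectral_sum :: "(real \<Rightarrow> real) \<Rightarrow> ('a::hilbert_space \<Rightarrow>\<^sub>L 'a) \<Rightarrow> ('a \<Rightarrow>\<^sub>L 'a) \<Rightarrow> bool" where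
  "has_spectral_sum g T S \<longleftrightarrow> (\<forall>x. ((\<lambda>l. spectral_series g T l x) has_sum S x) (point_spectrum T))"

lemma has_spectral_sum_unique: "has_spectral_sum g T S \<Longrightarrow> has_spectral_sum g T S' \<Longrightarrow> S = S'"
  unfolding has_spectral_sum_def by (blast intro: blinfun_eqI has_sum_unique)

definition spectral_fun :: "(real \<Rightarrow> real) \<Rightarrow> ('a::hilbert_space \<Rightarrow>\<^sub>L 'a) \<Rightarrow> 'a \<Rightarrow>\<^sub>L 'a" where
  "spectral_fun g T = (if \<exists>S. has_spectral_sum g T S then THE S. has_spectral_sum g T S else 0)"

lemma spectral_fun_eqI: "has_spectral_sum g T S \<Longrightarrow> spectral_fun g T = S"
  unfolding spectral_fun_def by (metis has_spectral_sum_unique the_equality)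

lemma has_spectral_sum_norm:
  assumes "norm_convergent_spectral_series g T"
  shows "has_spectral_sum g T (\<Sum>\<^sub>\<infinity>l\<in>point_spectrum T. spectral_series g T l)"
  unfolding has_spectral_sum_def
proof
  fix x
  show "((\<lambda>l. spectral_series g T l x) has_sum (\<Sum>\<^sub>\<infinity>l\<in>point_spectrum T. spectral_series g T l) x) (point_spectrum T)"
    by (rule has_sum_bounded_linear[OF blinfun.bounded_linear_left has_sum_infsum])
       (use assms in \<open>simp add: norm_convergent_spectral_series_def\<close>)
qed

lemma spectral_fun_norm:
  "norm_convergent_spectral_series g T \<Longrightarrow>
     (spectral_series g T has_sum spectral_fun g T) (point_spectrum T)"
  using spectral_fun_eqI[OF has_spectral_sum_norm, of g T]
  by (simp add: norm_convergent_spectral_series_def)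

end

theory Submission
  imports Defs
begin

text \<open>Right multiplication \<open>B \<mapsto> A\<^sub>B\<close> is linear, it reverses products, and it is
  isometric for the operator norms when \<open>\<Y> \<noteq> {0}\<close>, as testing \<open>A\<^sub>B\<close> on operators of
  rank one shows (\<open>norm_right_mult\<close>). Everything rests on the fact that it carries the
  projections of \<open>C\<close> to those of \<open>A\<^sub>C\<close> (\<open>right_mult_eigenproj\<close>): if \<open>P\<close> projects onto the
  \<open>\<lambda>\<close>-eigenspace of \<open>C\<close>, then \<open>A\<^sub>P\<close> is idempotent and contractive, which already makes it an orthogonal
  projection, and its range is the \<open>\<lambda>\<close>-eigenspace of \<open>A\<^sub>C\<close> because \<open>\<theta> C = \<lambda> \<theta>\<close> is equivalent to
  \<open>\<theta> P = \<theta>\<close>. Since an eigenvalue is a number whose eigenprojection is nonzero, injectivity of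
  \<open>B \<mapsto> A\<^sub>B\<close> gives \<open>\<sigma>\<^sub>p(A\<^sub>C) = \<sigma>\<^sub>p(C)\<close>. So the series for \<open>g(A\<^sub>C)\<close> is the image, term by term, of the
  series for \<open>g(C)\<close> under a linear isometry of Banach spaces, and the two converge in norm
  together.

  The operators \<open>g(C)\<close> and \<open>g(A\<^sub>C)\<close> are only pointwise sums, and the isometry does not
  transport pointwise convergence. The series of an operator with orthogonal eigenspaces converges
  pointwise to a bounded operator exactly when \<open>g\<close> is bounded on the point spectrum
  (\<open>ex_spectral_sum_iff_bounded\<close>), and this condition is the same for \<open>C\<close> and \<open>A\<^sub>C\<close>. If it
  fails, both operators have the default value 0. If it holds, both sums exist, and evaluating
  \<open>g(A\<^sub>C)[\<theta>]\<close> at a vector \<open>x\<close> gives \<open>\<Sum>\<^bsub>\<lambda>\<^esub> g(\<lambda>) \<theta> P\<^bsub>\<lambda>\<^esub> x = \<theta> (g(C) x)\<close>.\<close>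

section \<open>Orthogonal projections\<close>

lemma orth_proj_eqI:
  fixes E :: "'a::hilbert_space set"
  assumes E: "closed E" "subspace E" and z: "z \<in> E" "\<And>y. y \<in> E \<Longrightarrow> inner (x - z) y = 0"
  shows "orth_proj E x = z"
proof -
  let ?d = "orth_proj E x - z"
  have d: "?d \<in> E" using orth_proj_works(1)[OF E] z(1) E(2) by (simp add: subspace_diff)
  have "inner ?d ?d = inner (x - z) ?d - inner (x - orth_proj E x) ?d"
    by (simp add: inner_diff_left)
  also have "\<dots> = 0" using z(2)[OF d] orth_proj_works(2)[OF E d] by simp
  finally show ?thesis by simp
qed

lemma orth_proj_in_id:
  fixes E :: "'a::hilbert_space set"
  assumes "closed E" "subspace E" "x \<in> E"
  shows "orth_proj E x = x"
  by (rule orth_proj_eqI) (use assms in auto)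

lemma norm_orth_proj_le:
  fixes E :: "'a::hilbert_space set"
  assumes E: "closed E" "subspace E"
  shows "norm (orth_proj E) \<le> 1"
proof (rule norm_blinfun_bound)
  fix x
  let ?p = "orth_proj E x"
  have "(norm x)\<^sup>2 = (norm (x - ?p + ?p))\<^sup>2" by simp
  also have "\<dots> = (norm (x - ?p))\<^sup>2 + (norm ?p)\<^sup>2"
    by (rule norm_add_Pythagorean) (simp add: orthogonal_def orth_proj_works[OF E])
  finally have "(norm ?p)\<^sup>2 \<le> (norm x)\<^sup>2" by simp
  then show "norm ?p \<le> 1 * norm x" by (auto intro: power2_le_imp_le)
qed simp

text \<open>For \<open>n\<close> in the range of \<open>Q\<close> and \<open>k\<close> in its kernel, \<open>n = Q (n + t k)\<close> is at most as long as
  \<open>n + t k\<close> for every real \<open>t\<close>; a quadratic in \<open>t\<close> with minimum at 0 has no linear term. So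
  orthogonality of the range and kernel of \<open>A\<^sub>P\<close> comes from a norm bound.\<close>

lemma contractive_idempotent_orthogonal:
  fixes Q :: "'a::real_inner \<Rightarrow>\<^sub>L 'a"
  assumes idem: "\<And>x. Q (Q x) = Q x" and contr: "norm Q \<le> 1"
  shows "inner (x - Q x) (Q y) = 0"
proof (rule ccontr)
  define k n where "k = x - Q x" and "n = Q y"
  assume "inner (x - Q x) (Q y) \<noteq> 0"
  then have ne: "inner n k \<noteq> 0" by (simp add: k_def n_def inner_commute)
  have "0 \<le> 2 * t * inner n k + t\<^sup>2 * (norm k)\<^sup>2" for t
  proof -
    have "Q (n + t *\<^sub>R k) = n"
      by (simp add: k_def n_def idem blinfun.add_right blinfun.diff_right blinfun.scaleR_right)
    then have "norm n \<le> norm Q * norm (n + t *\<^sub>R k)" using norm_blinfun[of Q "n + t *\<^sub>R k"] by simp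
    also have "\<dots> \<le> 1 * norm (n + t *\<^sub>R k)" by (rule mult_right_mono[OF contr]) simp
    finally have "(norm n)\<^sup>2 \<le> (norm (n + t *\<^sub>R k))\<^sup>2" by (simp add: power_mono)
    then show ?thesis
      unfolding power2_norm_eq_inner
      by (simp add: inner_add_left inner_add_right inner_commute power2_eq_square algebra_simps)
  qed
  \<comment> \<open>the minimum of the quadratic\<close>
  from this[of "- inner n k / (norm k)\<^sup>2"]
  have "(inner n k)\<^sup>2 / (norm k)\<^sup>2 \<le> 0"
    by (cases "k = 0") (simp_all add: power2_eq_square field_simps)
  moreover have "k \<noteq> 0" using ne by auto
  ultimately show False using ne by (simp add: divide_le_0_iff)
qed

section \<open>Spectral sums of operators with orthogonal eigenspaces\<close>

text \<open>Spectral sums are treated under this condition because \<open>A\<^sub>C\<close> inherits it from \<open>C\<close> by algebra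
  with the eigenprojections.\<close>

definition orthogonal_eigenspaces :: "('a::hilbert_space \<Rightarrow>\<^sub>L 'a) \<Rightarrow> bool" where
  "orthogonal_eigenspaces T \<longleftrightarrow>
     (\<forall>l m. l \<noteq> m \<longrightarrow> (\<forall>x\<in>eigenspace T l. \<forall>y\<in>eigenspace T m. inner x y = 0))"

lemma eigenspace_iff: "x \<in> eigenspace T l \<longleftrightarrow> T x = l *\<^sub>R x"
  by (simp add: eigenspace_def blinfun.diff_left blinfun.scaleR_left)

lemmas eigenproj_works = orth_proj_works[OF closed_subspace_eigenspace]
lemmas eigenproj_eqI = orth_proj_eqI[OF closed_subspace_eigenspace]
lemmas eigenproj_id = orth_proj_in_id[OF closed_subspace_eigenspace]

lemma selfadjoint_orthogonal_eigenspaces: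
  assumes "selfadjoint T"
  shows "orthogonal_eigenspaces T"
  unfolding orthogonal_eigenspaces_def
proof (intro allI impI ballI)
  fix l m :: real and x y
  assume "l \<noteq> m" "x \<in> eigenspace T l" "y \<in> eigenspace T m"
  then have "l * inner x y = m * inner x y"
    using assms unfolding selfadjoint_def eigenspace_iff by (metis inner_scaleR_left inner_scaleR_right)
  then show "inner x y = 0" using \<open>l \<noteq> m\<close> by simp
qed

lemma point_spectrum_iff_eigenproj:
  "l \<in> point_spectrum T \<longleftrightarrow> orth_proj (eigenspace T l) \<noteq> 0"
proof
  assume "l \<in> point_spectrum T"
  then obtain x where x: "x \<noteq> 0" "x \<in> eigenspace T l"
    by (auto simp: point_spectrum_def eigenspace_iff)
  then show "orth_proj (eigenspace T l) \<noteq> 0" using eigenproj_id[OF x(2)] by auto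
next
  assume "orth_proj (eigenspace T l) \<noteq> 0"
  then obtain x where "orth_proj (eigenspace T l) x \<noteq> 0" by (metis blinfun_eqI zero_blinfun.rep_eq)
  then show "l \<in> point_spectrum T"
    using eigenproj_works(1)[of T l x] by (auto simp: point_spectrum_def eigenspace_iff)
qed

lemma orthonormal_multiplier:
  fixes B :: "'a::hilbert_space set"
  assumes B: "orthonormal B" and h: "\<And>e. e \<in> B \<Longrightarrow> \<bar>h e\<bar> \<le> b" and b: "0 \<le> b"
  obtains s where "((\<lambda>e. (h e * inner x e) *\<^sub>R e) has_sum s) B" "norm s \<le> b * norm x"
proof -
  let ?c = "\<lambda>e. h e * inner x e"
  have le: "(?c e)\<^sup>2 \<le> b\<^sup>2 * (inner x e)\<^sup>2" if "e \<in> B" for e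
    unfolding power_mult_distrib
    using h[OF that] b by (intro mult_right_mono) (auto simp: abs_le_square_iff[symmetric])
  have "(\<lambda>e. (?c e)\<^sup>2) summable_on B"
    by (rule summable_on_comparison_test[OF summable_on_cmult_right[OF orthonormal_summable_coeffs(1)[OF B, of x]]])
       (use le in auto)
  then obtain s where s: "((\<lambda>e. ?c e *\<^sub>R e) has_sum s) B"
    using orthonormal_summable_on[OF B, of ?c] unfolding summable_on_def by blast
  have fin: "norm (\<Sum>e\<in>F. ?c e *\<^sub>R e) \<le> b * norm x" if F: "finite F" "F \<subseteq> B" for F
  proof -
    have "(norm (\<Sum>e\<in>F. ?c e *\<^sub>R e))\<^sup>2 = (\<Sum>e\<in>F. (?c e)\<^sup>2)"
      by (rule orthonormal_norm_sum[OF B F])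
    also have "\<dots> \<le> (\<Sum>e\<in>F. b\<^sup>2 * (inner x e)\<^sup>2)" by (rule sum_mono) (use le F in auto)
    also have "\<dots> = b\<^sup>2 * (\<Sum>e\<in>F. (inner x e)\<^sup>2)" by (simp add: sum_distrib_left)
    also have "\<dots> \<le> b\<^sup>2 * (norm x)\<^sup>2"
      by (intro mult_left_mono bessel orthonormal_subset[OF B] F) simp
    finally show ?thesis using b by (auto simp: power_mult_distrib[symmetric] intro: power2_le_imp_le)
  qed
  have "norm s \<le> b * norm x"
    by (rule tendsto_upperbound[OF tendsto_norm[OF s[unfolded has_sum_def]]])
       (use fin in \<open>auto intro: eventually_finite_subsets_at_top_weakI\<close>)
  then show thesis using that s by blast
qed

text \<open>The nonzero components of \<open>x\<close> in the eigenspaces, scaled to length 1, form an orthonormal set,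
  and on it the series multiplies the Fourier coefficients of \<open>x\<close> by a bounded factor.\<close>

lemma spectral_series_pointwise:
  fixes T :: "'a::hilbert_space \<Rightarrow>\<^sub>L 'a"
  assumes T: "orthogonal_eigenspaces T"
    and g: "\<And>l. l \<in> point_spectrum T \<Longrightarrow> \<bar>g l\<bar> \<le> b" and b: "0 \<le> b"
  obtains s where "((\<lambda>l. spectral_series g T l x) has_sum s) (point_spectrum T)" "norm s \<le> b * norm x"
proof -
  define p where "p l = orth_proj (eigenspace T l) x" for l
  define L where "L = {l. p l \<noteq> 0}"
  define u where "u l = p l /\<^sub>R norm (p l)" for l
  \<comment> \<open>the Rayleigh quotient recovers the eigenvalue of a unit eigenvector\<close>
  define h where "h e = g (inner (T e) e)" for e
  have pE: "p l \<in> eigenspace T l" for l unfolding p_def by (rule eigenproj_works)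
  have Tu: "T (u l) = l *\<^sub>R u l" for l
    using pE[of l] by (simp add: u_def eigenspace_iff blinfun.scaleR_right)
  have nu: "norm (u l) = 1" if "l \<in> L" for l using that by (simp add: u_def L_def)
  have hu: "h (u l) = g l" if "l \<in> L" for l
    using nu[OF that] by (simp add: h_def Tu dot_square_norm)
  have orth: "inner (u l) (u m) = 0" if "l \<noteq> m" for l m
    using T that unfolding orthogonal_eigenspaces_def by (metis Tu eigenspace_iff)
  have inj: "inj_on u L"
    by (rule inj_onI) (metis nu orth inner_eq_zero_iff norm_zero zero_neq_one)
  have B: "orthonormal (u ` L)"
    unfolding orthonormal_def pairwise_def orthogonal_def using nu orth by (metis imageE)
  have L: "L \<subseteq> point_spectrum T"
    using pE by (auto simp: L_def point_spectrum_def eigenspace_iff)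
  have "\<bar>h e\<bar> \<le> b" if "e \<in> u ` L" for e using that hu g L by auto
  from orthonormal_multiplier[of _ h, OF B this b] obtain s
    where s: "((\<lambda>e. (h e * inner x e) *\<^sub>R e) has_sum s) (u ` L)" "norm s \<le> b * norm x" by blast
  have xu: "inner x (p l) = (norm (p l))\<^sup>2" for l
    using eigenproj_works(2)[OF pE[of l], of x] unfolding p_def
    by (simp add: inner_diff_left power2_norm_eq_inner)
  have term_eq: "(h (u l) * inner x (u l)) *\<^sub>R u l = spectral_series g T l x" if "l \<in> L" for l
  proof -
    have "inner x (u l) *\<^sub>R u l = p l"
      using that by (simp add: u_def xu L_def power2_eq_square divide_simps)
    then show ?thesis
      by (simp add: hu[OF that] spectral_series_def blinfun.scaleR_left p_def flip: scaleR_scaleR)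
  qed
  have "((\<lambda>l. (h (u l) * inner x (u l)) *\<^sub>R u l) has_sum s) L"
    using s(1) has_sum_reindex[OF inj, of "\<lambda>e. (h e * inner x e) *\<^sub>R e" s] by (simp add: o_def)
  also have "?this \<longleftrightarrow> ((\<lambda>l. spectral_series g T l x) has_sum s) (point_spectrum T)"
    by (rule has_sum_cong_neutral)
       (use L term_eq in \<open>auto simp: L_def p_def spectral_series_def blinfun.scaleR_left\<close>)
  finally show thesis using that s(2) by blast
qed

text \<open>A sum \<open>S\<close> acts as \<open>g(l)\<close> on the eigenvectors for \<open>l\<close>, whence \<open>\<bar>g(l)\<bar> \<le> \<parallel>S\<parallel>\<close>. Conversely, a
  bound on \<open>g\<close> makes the series converge at each vector, with the same bound for the sum.\<close>

lemma ex_spectral_sum_iff_bounded: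
  fixes T :: "'a::hilbert_space \<Rightarrow>\<^sub>L 'a"
  assumes T: "orthogonal_eigenspaces T"
  shows "(\<exists>S. has_spectral_sum g T S) \<longleftrightarrow> bounded (g ` point_spectrum T)"
proof
  assume "\<exists>S. has_spectral_sum g T S"
  then obtain S :: "'a \<Rightarrow>\<^sub>L 'a" where S: "\<And>x. ((\<lambda>l. spectral_series g T l x) has_sum S x) (point_spectrum T)"
    by (auto simp: has_spectral_sum_def)
  have "\<bar>g l\<bar> \<le> norm S" if l: "l \<in> point_spectrum T" for l
  proof -
    obtain x where x: "x \<noteq> 0" "x \<in> eigenspace T l"
      using l by (auto simp: point_spectrum_def eigenspace_iff)
    have "orth_proj (eigenspace T m) x = 0" if "m \<noteq> l" for m
    proof (rule eigenproj_eqI)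
      show "0 \<in> eigenspace T m" by (simp add: eigenspace_iff)
      show "inner (x - 0) y = 0" if "y \<in> eigenspace T m" for y
        using T[unfolded orthogonal_eigenspaces_def, rule_format, OF \<open>m \<noteq> l\<close> that x(2)]
        by (simp add: inner_commute)
    qed
    then have "((\<lambda>m. spectral_series g T m x) has_sum g l *\<^sub>R x) (point_spectrum T)"
      by (intro has_sum_finite_neutralI[of "{l}"])
         (use l eigenproj_id[OF x(2)] in \<open>auto simp: spectral_series_def blinfun.scaleR_left\<close>)
    then have "S x = g l *\<^sub>R x" by (rule has_sum_unique[OF S])
    then have "\<bar>g l\<bar> * norm x \<le> norm S * norm x" using norm_blinfun[of S x] by simp
    then show ?thesis using x(1) by simp
  qed
  then show "bounded (g ` point_spectrum T)" by (auto simp: bounded_iff)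
next
  assume "bounded (g ` point_spectrum T)"
  then obtain b where b: "0 \<le> b" "\<And>l. l \<in> point_spectrum T \<Longrightarrow> \<bar>g l\<bar> \<le> b"
    unfolding bounded_pos by (auto intro: less_imp_le)
  have "\<exists>s. ((\<lambda>l. spectral_series g T l x) has_sum s) (point_spectrum T) \<and> norm s \<le> b * norm x" for x
    using spectral_series_pointwise[where g = g and x = x, OF T b(2,1)] by blast
  then obtain S :: "'a \<Rightarrow> 'a"
    where S: "\<And>x. ((\<lambda>l. spectral_series g T l x) has_sum S x) (point_spectrum T)"
    and bound: "\<And>x. norm (S x) \<le> b * norm x" by metis
  have "bounded_linear S"
  proof (rule bounded_linear_intro)
    fix x y :: 'a and r :: real
    show "S (x + y) = S x + S y"
      by (rule has_sum_unique[OF S]) (use has_sum_add[OF S S] in \<open>simp add: blinfun.add_right\<close>)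
    show "S (r *\<^sub>R x) = r *\<^sub>R S x"
      by (rule has_sum_unique[OF S])
         (use has_sum_bounded_linear[OF bounded_linear_scaleR_right S] in \<open>simp add: blinfun.scaleR_right\<close>)
    show "norm (S x) \<le> norm x * b" using bound[of x] by (simp add: mult.commute)
  qed
  then have "has_spectral_sum g T (Blinfun S)"
    using S by (simp add: has_spectral_sum_def bounded_linear_Blinfun_apply)
  then show "\<exists>S. has_spectral_sum g T S" ..
qed

section \<open>The isometry from B to right multiplication by B\<close>

text \<open>If the image series converges, its net of finite partial sums is Cauchy, so that of the
  original series is Cauchy as well, and the domain of \<open>h\<close> is complete.\<close>

lemma summable_on_isometry_iff:
  fixes h :: "'b::banach \<Rightarrow> 'c::real_normed_vector"
  assumes h: "bounded_linear h" and iso: "\<And>x. norm (h x) = norm x"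
  shows "(\<lambda>i. h (f i)) summable_on A \<longleftrightarrow> f summable_on A"
proof
  interpret h: bounded_linear h by (rule h)
  have dist: "dist (\<Sum>i\<in>F. h (f i)) (\<Sum>i\<in>G. h (f i)) = dist (sum f F) (sum f G)" for F G
    unfolding dist_norm by (simp add: iso flip: h.sum h.diff)
  assume "(\<lambda>i. h (f i)) summable_on A"
  then have "convergent_filter (filtermap (\<lambda>F. \<Sum>i\<in>F. h (f i)) (finite_subsets_at_top A))"
    by (auto simp: summable_on_def has_sum_def convergent_filter_iff filterlim_def)
  then have "cauchy_filter (filtermap (\<lambda>F. \<Sum>i\<in>F. h (f i)) (finite_subsets_at_top A))"
    by (rule convergent_filter_cauchy)
  then have "cauchy_filter (filtermap (sum f) (finite_subsets_at_top A))"
    unfolding cauchy_filter_metric_filtermap dist .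
  then have "convergent_filter (filtermap (sum f) (finite_subsets_at_top A))"
    by (rule cauchy_filter_convergent)
  then show "f summable_on A"
    by (auto simp: summable_on_def has_sum_def convergent_filter_iff filterlim_def)
next
  show "f summable_on A \<Longrightarrow> (\<lambda>i. h (f i)) summable_on A"
    by (rule summable_on_bounded_linear[OF h])
qed

lift_definition rank_one :: "'b::hilbert_space \<Rightarrow> 'a::hilbert_space \<Rightarrow> ('a, 'b) hs"
  is "\<lambda>y v. blinfun_scaleR_left y o\<^sub>L blinfun_inner_left v"
proof -
  fix y :: 'b and v :: 'a
  have "(\<lambda>e. (norm y)\<^sup>2 * (inner v e)\<^sup>2) summable_on some_onb"
    by (intro summable_on_cmult_right has_sum_imp_summable[OF parseval_norm[OF orthonormal_basis_some_onb]])
  then show "hilbert_schmidt (blinfun_scaleR_left y o\<^sub>L blinfun_inner_left v)"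
    by (simp add: hilbert_schmidt_def power_mult_distrib inner_commute mult.commute)
qed

lemma hs_op_rank_one: "hs_op (rank_one y v) x = inner v x *\<^sub>R y"
  by (simp add: rank_one.rep_eq inner_commute)

lemma norm_rank_one: "norm (rank_one y v) = norm y * norm v"
proof -
  have "((\<lambda>e. (norm y)\<^sup>2 * (inner v e)\<^sup>2) has_sum (norm y)\<^sup>2 * (norm v)\<^sup>2) some_onb"
    by (intro has_sum_cmult_right parseval_norm orthonormal_basis_some_onb)
  moreover have "((\<lambda>e. (norm y)\<^sup>2 * (inner v e)\<^sup>2) has_sum (norm (rank_one y v))\<^sup>2) some_onb"
    using norm_hs_has_sum[of "rank_one y v"]
    by (simp add: hs_op_rank_one power_mult_distrib mult.commute)
  ultimately have "(norm (rank_one y v))\<^sup>2 = (norm y * norm v)\<^sup>2"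
    unfolding power_mult_distrib by (rule has_sum_unique[symmetric])
  then show ?thesis by (simp add: power2_eq_iff_nonneg)
qed

lemma hs_eqI: "(\<And>x. hs_op \<theta> x = hs_op \<eta> x) \<Longrightarrow> \<theta> = \<eta>"
  by (metis blinfun_eqI hs_op_inject)

lemma norm_right_mult_le: "norm (right_mult B) \<le> norm B"
  by (rule norm_blinfun_bound) (simp_all add: right_mult.rep_eq norm_hs_comp mult.commute)

lemma bounded_linear_right_mult: "bounded_linear right_mult"
proof (rule bounded_linear_intro)
  fix A B :: "'a::hilbert_space \<Rightarrow>\<^sub>L 'a" and r :: real
  show "(right_mult (A + B) :: ('a, 'b::hilbert_space) hs \<Rightarrow>\<^sub>L ('a, 'b) hs) = right_mult A + right_mult B"
    by (auto intro!: blinfun_eqI hs_eqI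
        simp: hs_op_right_mult blinfun.add_left blinfun.add_right plus_hs.rep_eq)
  show "(right_mult (r *\<^sub>R A) :: ('a, 'b) hs \<Rightarrow>\<^sub>L ('a, 'b) hs) = r *\<^sub>R right_mult A"
    by (auto intro!: blinfun_eqI hs_eqI
        simp: hs_op_right_mult blinfun.scaleR_left blinfun.scaleR_right scaleR_hs.rep_eq)
  show "norm (right_mult A :: ('a, 'b) hs \<Rightarrow>\<^sub>L ('a, 'b) hs) \<le> norm A * 1"
    by (simp add: norm_right_mult_le)
qed

text \<open>For the lower bound at a vector \<open>x\<close>, apply \<open>A\<^sub>B\<close> to the operator \<open>t\<close> of rank one built from
  \<open>B x\<close> and a vector \<open>y \<noteq> 0\<close>: then \<open>(t B) x = \<parallel>B x\<parallel>\<^sup>2 y\<close>, while \<open>\<parallel>t\<parallel> = \<parallel>y\<parallel> \<parallel>B x\<parallel>\<close>.\<close>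

lemma norm_right_mult:
  fixes B :: "'a::hilbert_space \<Rightarrow>\<^sub>L 'a"
  assumes "\<exists>y :: 'b::hilbert_space. y \<noteq> 0"
  shows "norm (right_mult B :: ('a, 'b) hs \<Rightarrow>\<^sub>L ('a, 'b) hs) = norm B"
proof (rule order_antisym[OF norm_right_mult_le norm_blinfun_bound])
  let ?A = "right_mult B :: ('a, 'b) hs \<Rightarrow>\<^sub>L ('a, 'b) hs"
  obtain y :: 'b where y: "y \<noteq> 0" using assms by blast
  fix x
  let ?t = "rank_one y (B x)"
  have "norm (B x) * norm (B x) * norm y = norm (hs_op (?A ?t) x)"
    by (simp add: hs_op_right_mult hs_op_rank_one dot_square_norm power2_eq_square)
  also have "\<dots> \<le> norm (hs_op (?A ?t)) * norm x" by (rule norm_blinfun)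
  also have "\<dots> \<le> norm (?A ?t) * norm x" by (intro mult_right_mono norm_hs_op_le) simp
  also have "\<dots> \<le> norm ?A * norm ?t * norm x" by (intro mult_right_mono norm_blinfun) simp
  finally have "norm (B x) * (norm (B x) * norm y) \<le> norm ?A * norm x * (norm (B x) * norm y)"
    by (simp add: norm_rank_one mult_ac)
  then show "norm (B x) \<le> norm ?A * norm x"
    using y by (cases "B x = 0") simp_all
qed simp

section \<open>Right multiplication by a self-adjoint operator\<close>

lemma selfadjoint_eigenproj_commute:
  assumes "selfadjoint C"
  shows "orth_proj (eigenspace C l) (C x) = l *\<^sub>R orth_proj (eigenspace C l) x"
proof (rule eigenproj_eqI)
  show "l *\<^sub>R orth_proj (eigenspace C l) x \<in> eigenspace C l"
    by (intro subspace_scale closed_subspace_eigenspace eigenproj_works)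
  fix y assume y: "y \<in> eigenspace C l"
  have "inner (C x - l *\<^sub>R orth_proj (eigenspace C l) x) y = l * inner (x - orth_proj (eigenspace C l) x) y"
    using assms y by (simp add: selfadjoint_def eigenspace_iff inner_diff_left right_diff_distrib)
  then show "inner (C x - l *\<^sub>R orth_proj (eigenspace C l) x) y = 0"
    using eigenproj_works(2)[OF y] by simp
qed

text \<open>If \<open>\<theta> C = l \<theta>\<close>, then \<open>C \<theta>\<^sup>* = l \<theta>\<^sup>*\<close>. So the range of \<open>\<theta>\<^sup>*\<close> lies in the eigenspace of \<open>C\<close>, and
  \<open>\<theta>\<close> vanishes on the orthogonal complement of that eigenspace.\<close>

lemma eigenvector_right_mult:
  fixes \<theta> :: "('a::hilbert_space, 'b::hilbert_space) hs"
  assumes C: "selfadjoint C" and \<theta>: "\<theta> \<in> eigenspace (right_mult C) l"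
  shows "hs_op \<theta> (orth_proj (eigenspace C l) x) = hs_op \<theta> x"
proof -
  let ?adj = "adjoint (blinfun_apply (hs_op \<theta>))"
  have \<theta>C: "hs_op \<theta> (C z) = l *\<^sub>R hs_op \<theta> z" for z
    using arg_cong[OF \<theta>[unfolded eigenspace_iff], of "\<lambda>\<eta>. hs_op \<eta> z"]
    by (simp add: hs_op_right_mult scaleR_hs.rep_eq blinfun.scaleR_left)
  have "inner z (C (?adj y)) = inner z (l *\<^sub>R ?adj y)" for y z
  proof -
    have "inner z (C (?adj y)) = inner (C z) (?adj y)" using C by (simp add: selfadjoint_def)
    also have "\<dots> = inner z (l *\<^sub>R ?adj y)" by (simp add: adjoint_blinfun_works \<theta>C)
    finally show ?thesis .
  qed
  then have adj: "?adj y \<in> eigenspace C l" for y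
    unfolding eigenspace_iff by (intro iffD1[OF vector_eq_ldot]) blast
  have "inner (hs_op \<theta> (x - orth_proj (eigenspace C l) x)) y = 0" for y
    using eigenproj_works(2)[OF adj] by (simp flip: adjoint_blinfun_works)
  from this[of "hs_op \<theta> (x - orth_proj (eigenspace C l) x)"] show ?thesis
    by (simp add: blinfun.diff_right)
qed

lemma right_mult_eigenproj:
  fixes C :: "'a::hilbert_space \<Rightarrow>\<^sub>L 'a"
  assumes C: "selfadjoint C"
  shows "(right_mult (orth_proj (eigenspace C l)) :: ('a, 'b::hilbert_space) hs \<Rightarrow>\<^sub>L ('a, 'b) hs) =
           orth_proj (eigenspace (right_mult C) l)"
proof (rule blinfun_eqI, rule eigenproj_eqI[symmetric])
  let ?P = "orth_proj (eigenspace C l)"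
  let ?Q = "right_mult ?P :: ('a, 'b) hs \<Rightarrow>\<^sub>L ('a, 'b) hs"
  fix \<theta> :: "('a, 'b) hs"
  show "?Q \<theta> \<in> eigenspace (right_mult C) l"
    by (auto intro!: hs_eqI simp: eigenspace_iff hs_op_right_mult scaleR_hs.rep_eq
        selfadjoint_eigenproj_commute[OF C] blinfun.scaleR_left blinfun.scaleR_right)
  have fix_eig: "?Q \<eta> = \<eta>" if "\<eta> \<in> eigenspace (right_mult C) l" for \<eta> :: "('a, 'b) hs"
    using eigenvector_right_mult[OF C that] by (auto intro!: hs_eqI simp: hs_op_right_mult)
  have "norm ?Q \<le> 1"
    using norm_right_mult_le norm_orth_proj_le[OF closed_subspace_eigenspace] by (rule order_trans)
  moreover have "?Q (?Q \<eta>) = ?Q \<eta>" for \<eta>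
    by (auto intro!: hs_eqI simp: hs_op_right_mult eigenproj_id eigenproj_works(1))
  ultimately have "inner (\<theta> - ?Q \<theta>) (?Q \<eta>) = 0" for \<eta>
    by (intro contractive_idempotent_orthogonal)
  then show "inner (\<theta> - ?Q \<theta>) \<eta> = 0" if "\<eta> \<in> eigenspace (right_mult C) l" for \<eta>
    using fix_eig[OF that] by metis
qed

text \<open>An eigenvector \<open>\<theta>\<close> for \<open>l\<close> satisfies \<open>\<theta> = \<theta> P\<^bsub>l\<^esub>\<close>, and so \<open>\<theta> P\<^bsub>m\<^esub> = \<theta> P\<^bsub>l\<^esub> P\<^bsub>m\<^esub> = 0\<close>; that is, the
  projection of \<open>\<theta>\<close> to the eigenspace of \<open>A\<^sub>C\<close> for \<open>m\<close> vanishes.\<close>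

lemma orthogonal_eigenspaces_right_mult:
  fixes C :: "'a::hilbert_space \<Rightarrow>\<^sub>L 'a"
  assumes C: "selfadjoint C"
  shows "orthogonal_eigenspaces (right_mult C :: ('a, 'b::hilbert_space) hs \<Rightarrow>\<^sub>L ('a, 'b) hs)"
  unfolding orthogonal_eigenspaces_def
proof (intro allI impI ballI)
  let ?A = "right_mult C :: ('a, 'b) hs \<Rightarrow>\<^sub>L ('a, 'b) hs"
  fix l m :: real and \<theta> \<eta>
  assume lm: "l \<noteq> m" and \<theta>: "\<theta> \<in> eigenspace ?A l" and \<eta>: "\<eta> \<in> eigenspace ?A m"
  have "orth_proj (eigenspace C l) (orth_proj (eigenspace C m) x) = 0" for x
  proof (rule eigenproj_eqI)
    show "0 \<in> eigenspace C l" by (simp add: eigenspace_iff)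
    show "inner (orth_proj (eigenspace C m) x - 0) y = 0" if "y \<in> eigenspace C l" for y
      using selfadjoint_orthogonal_eigenspaces[OF C, unfolded orthogonal_eigenspaces_def,
          rule_format, OF lm that eigenproj_works(1)]
      by (simp add: inner_commute)
  qed
  then have "hs_op \<theta> (orth_proj (eigenspace C m) x) = 0" for x
    using eigenvector_right_mult[OF C \<theta>] by (metis blinfun.zero_right)
  then have "orth_proj (eigenspace ?A m) \<theta> = 0"
    unfolding right_mult_eigenproj[OF C, symmetric]
    by (auto intro!: hs_eqI simp: hs_op_right_mult zero_hs.rep_eq)
  then show "inner \<theta> \<eta> = 0" using eigenproj_works(2)[OF \<eta>, of \<theta>] by simp
qed

lemma spectral_series_right_mult:
  assumes "selfadjoint C"
  shows "spectral_series g (right_mult C) l = right_mult (spectral_series g C l)"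
  unfolding spectral_series_def
  by (simp add: right_mult_eigenproj[OF assms] linear_cmul[OF bounded_linear.linear[OF bounded_linear_right_mult]])

lemma point_spectrum_right_mult:
  fixes C :: "'a::hilbert_space \<Rightarrow>\<^sub>L 'a"
  assumes "\<exists>y :: 'b::hilbert_space. y \<noteq> 0" "selfadjoint C"
  shows "point_spectrum (right_mult C :: ('a, 'b) hs \<Rightarrow>\<^sub>L ('a, 'b) hs) = point_spectrum C"
proof (rule set_eqI)
  fix l
  have "norm (orth_proj (eigenspace (right_mult C :: ('a, 'b) hs \<Rightarrow>\<^sub>L ('a, 'b) hs) l)) =
      norm (orth_proj (eigenspace C l))"
    by (simp add: norm_right_mult[OF assms(1)] flip: right_mult_eigenproj[OF assms(2)])
  then show "l \<in> point_spectrum (right_mult C :: ('a, 'b) hs \<Rightarrow>\<^sub>L ('a, 'b) hs) \<longleftrightarrow> l \<in> point_spectrum C"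
    unfolding point_spectrum_iff_eigenproj by (metis norm_eq_zero)
qed

text \<open>Evaluation of an operator at a fixed vector is continuous in the Hilbert--Schmidt norm, so the sum \<open>R\<close> can be
  computed one vector at a time.\<close>

lemma has_spectral_sum_right_mult_eq:
  fixes C :: "'a::hilbert_space \<Rightarrow>\<^sub>L 'a" and R :: "('a, 'b::hilbert_space) hs \<Rightarrow>\<^sub>L ('a, 'b) hs"
  assumes y: "\<exists>y :: 'b. y \<noteq> 0" and C: "selfadjoint C"
    and S: "has_spectral_sum g C S" and R: "has_spectral_sum g (right_mult C) R"
  shows "R = right_mult S"
proof (intro blinfun_eqI hs_eqI)
  fix \<theta> :: "('a, 'b) hs" and x
  have lin: "bounded_linear (\<lambda>\<eta> :: ('a, 'b) hs. hs_op \<eta> x)"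
  proof (rule bounded_linear_intro)
    show "norm (hs_op \<eta> x) \<le> norm \<eta> * norm x" for \<eta> :: "('a, 'b) hs"
      using norm_blinfun mult_right_mono[OF norm_hs_op_le norm_ge_zero] by (rule order_trans)
  qed (simp_all add: plus_hs.rep_eq scaleR_hs.rep_eq blinfun.add_left blinfun.scaleR_left)
  have "((\<lambda>l. hs_op (spectral_series g (right_mult C) l \<theta>) x) has_sum hs_op (R \<theta>) x) (point_spectrum C)"
    using has_sum_bounded_linear[OF lin R[unfolded has_spectral_sum_def, rule_format, of \<theta>]]
    by (simp add: point_spectrum_right_mult[OF y C])
  then have "((\<lambda>l. hs_op \<theta> (spectral_series g C l x)) has_sum hs_op (R \<theta>) x) (point_spectrum C)"
    by (simp add: spectral_series_right_mult[OF C] hs_op_right_mult)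
  moreover have "((\<lambda>l. hs_op \<theta> (spectral_series g C l x)) has_sum hs_op \<theta> (S x)) (point_spectrum C)"
    using S unfolding has_spectral_sum_def
    by (intro has_sum_bounded_linear[OF blinfun.bounded_linear_right]) blast
  ultimately show "hs_op (R \<theta>) x = hs_op (right_mult S \<theta>) x"
    by (simp add: hs_op_right_mult has_sum_unique)
qed

theorem corollary3p19:
  fixes C :: "'x::{hilbert_space, second_countable_topology} \<Rightarrow>\<^sub>L 'x"
    and g :: "real \<Rightarrow> real"
  assumes "\<exists>y :: 'y::{hilbert_space, second_countable_topology}. y \<noteq> 0"
    and "compact_operator C"
    and "selfadjoint C"
  shows "(right_mult (spectral_fun g C) :: ('x, 'y) hs \<Rightarrow>\<^sub>L ('x, 'y) hs) =
           spectral_fun g (right_mult C)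
       \<and> (norm_convergent_spectral_series g C \<longleftrightarrow>
           norm_convergent_spectral_series g (right_mult C :: ('x, 'y) hs \<Rightarrow>\<^sub>L ('x, 'y) hs))"
proof
  let ?A = "right_mult C :: ('x, 'y) hs \<Rightarrow>\<^sub>L ('x, 'y) hs"
  note spec = point_spectrum_right_mult[OF assms(1,3)]
  have ex: "(\<exists>R. has_spectral_sum g ?A R) \<longleftrightarrow> (\<exists>S. has_spectral_sum g C S)"
    using assms(3)
    by (simp add: ex_spectral_sum_iff_bounded orthogonal_eigenspaces_right_mult
        selfadjoint_orthogonal_eigenspaces spec)
  show "right_mult (spectral_fun g C) = spectral_fun g ?A"
  proof (cases "\<exists>S. has_spectral_sum g C S")
    case True
    then obtain S R where S: "has_spectral_sum g C S" and R: "has_spectral_sum g ?A R"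
      using ex by blast
    then show ?thesis
      using has_spectral_sum_right_mult_eq[OF assms(1,3) S R]
      by (simp add: spectral_fun_eqI)
  next
    case False
    then show ?thesis
      using ex by (simp add: spectral_fun_def linear_0[OF bounded_linear.linear[OF bounded_linear_right_mult]])
  qed
  show "norm_convergent_spectral_series g C \<longleftrightarrow> norm_convergent_spectral_series g ?A"
    unfolding norm_convergent_spectral_series_def spec
      ext[of "spectral_series g ?A", OF spectral_series_right_mult[OF assms(3)]]
    by (rule summable_on_isometry_iff[symmetric, OF bounded_linear_right_mult norm_right_mult[OF assms(1)]])
qed

end
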